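(* Let $k$ be an algebraically closed field, let $A$ be an associative $k$-algebra with identity, and let $G$ be a finite abelian group with $\operatorname{char}(k)\nmid |G|$ acting on $A$ by $k$-algebra automorphisms. Fix an isomorphism $g\mapsto\chi_g$ from $G$ to its character group $G^\vee$. Then for any normalised 2-cocycle $\mu$ of $G$ with values in $k^\times$ there is an isomorphism of $k$-algebras $A^{G,\mu}\cong (AG_\mu)^G$.
   Context: The action of $g\in G$ is written $a\mapsto a^g$. A normalised 2-cocycle is a function $\mu:G\times G\to k^\times$ with $\mu(g,h)\mu(gh,l)=\mu(g,hl)\mu(h,l)$ and $\mu(e,g)=\mu(g,e)=1$ for all $g,h,l\in G$, where $e$ is the identity of $G$. The action induces a $G$-grading $A=\bigoplus_{g\in G}A_g$ with $A_g=\{a\in A: a^h=\chi_{g^{-1}}(h)a\ \ \forall h\in G\}$. The cocycle twist $A^{G,\mu}$ is the vector space $A$ with the new multiplication determined by $a\ast_\mu b=\mu(g,h)ab$ for $a\in A_g$, $b\in A_h$. The twisted group algebra $AG_\mu$ is the vector space $A\otimes_k kG$ with multiplication $(a\otimes g)(b\otimes h)=\mu(g,h)\,ab\otimes gh$. The group $G$ acts on $AG_\mu$ by $k$-algebra automorphisms via $(a\otimes g)^h=\chi_g(h)(a^h\otimes g)$, and $(AG_\mu)^G$ is the invariant subring. The same isomorphism $g\mapsto \chi_g$ is used in both constructions. *)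

theory Defs
  imports "HOL-Algebra.Algebra"
begin

section \<open>Associative unital algebras over a commutative ring\<close>

text \<open>The library locale \<open>algebra\<close> requires the multiplication to be commutative, so it does not
  cover general associative algebras. The zero algebra is allowed.\<close>

locale assoc_algebra = module + ring M +
  assumes smult_mult_left:
      "\<lbrakk>a \<in> carrier R; x \<in> carrier M; y \<in> carrier M\<rbrakk> \<Longrightarrow>
        (a \<odot>\<^bsub>M\<^esub> x) \<otimes>\<^bsub>M\<^esub> y = a \<odot>\<^bsub>M\<^esub> (x \<otimes>\<^bsub>M\<^esub> y)"
    and smult_mult_right:
      "\<lbrakk>a \<in> carrier R; x \<in> carrier M; y \<in> carrier M\<rbrakk> \<Longrightarrow>
        x \<otimes>\<^bsub>M\<^esub> (a \<odot>\<^bsub>M\<^esub> y) = a \<odot>\<^bsub>M\<^esub> (x \<otimes>\<^bsub>M\<^esub> y)"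

definition alg_iso ::
    "('k, 'l) ring_scheme \<Rightarrow> ('k, 'a, 'm) module_scheme \<Rightarrow> ('k, 'b, 'n) module_scheme \<Rightarrow> ('a \<Rightarrow> 'b) set"
  where "alg_iso K A B =
    {f \<in> ring_iso A B. \<forall>c \<in> carrier K. \<forall>x \<in> carrier A. f (c \<odot>\<^bsub>A\<^esub> x) = c \<odot>\<^bsub>B\<^esub> f x}"

text \<open>Being isomorphic as algebras includes that both structures really are algebras.\<close>

definition alg_isomorphic ::
    "('k, 'l) ring_scheme \<Rightarrow> ('k, 'a, 'm) module_scheme \<Rightarrow> ('k, 'b, 'n) module_scheme \<Rightarrow> bool"
  where "alg_isomorphic K A B \<longleftrightarrow>
    assoc_algebra K A \<and> assoc_algebra K B \<and> alg_iso K A B \<noteq> {}"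

definition ring_char :: "('k, 'l) ring_scheme \<Rightarrow> nat"
  where "ring_char K =
    (if \<exists>n>0. add_pow K (n::nat) \<one>\<^bsub>K\<^esub> = \<zero>\<^bsub>K\<^esub>
     then LEAST n. n > 0 \<and> add_pow K (n::nat) \<one>\<^bsub>K\<^esub> = \<zero>\<^bsub>K\<^esub> else 0)"


section \<open>Actions, characters and cocycles\<close>

text \<open>Throughout, \<open>\<phi> h a\<close> is the element written \<open>a\<close> to the power \<open>h\<close> in exponential notation. The
  library's \<open>group_action\<close> is a left action; for the abelian groups considered here the
  distinction between left and right actions disappears.\<close>

definition acts_by_alg_auts ::
    "('k, 'l) ring_scheme \<Rightarrow> ('k, 'a, 'm) module_scheme \<Rightarrow> ('g, 'n) monoid_scheme \<Rightarrow>
      ('g \<Rightarrow> 'a \<Rightarrow> 'a) \<Rightarrow> bool"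
  where "acts_by_alg_auts K A G \<phi> \<longleftrightarrow>
    group_action G (carrier A) \<phi> \<and> (\<forall>h \<in> carrier G. \<phi> h \<in> alg_iso K A A)"

text \<open>Characters are extensional functions, so that distinct elements of the carrier are
  distinct characters.\<close>

definition character_group ::
    "('g, 'n) monoid_scheme \<Rightarrow> ('k, 'l) ring_scheme \<Rightarrow> ('g \<Rightarrow> 'k) monoid"
  where "character_group G K =
    \<lparr>carrier = hom G (mult_of K) \<inter> extensional (carrier G),
     monoid.mult = (\<lambda>\<psi> \<psi>'. \<lambda>h \<in> carrier G. \<psi> h \<otimes>\<^bsub>K\<^esub> \<psi>' h),
     one = (\<lambda>h \<in> carrier G. \<one>\<^bsub>K\<^esub>)\<rparr>"

definition normalised_2_cocycle ::
    "('g, 'n) monoid_scheme \<Rightarrow> ('k, 'l) ring_scheme \<Rightarrow> ('g \<Rightarrow> 'g \<Rightarrow> 'k) \<Rightarrow> bool"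
  where "normalised_2_cocycle G K \<mu> \<longleftrightarrow>
    (\<forall>g \<in> carrier G. \<forall>h \<in> carrier G. \<mu> g h \<in> carrier (mult_of K)) \<and>
    (\<forall>g \<in> carrier G. \<forall>h \<in> carrier G. \<forall>l \<in> carrier G.
       \<mu> g h \<otimes>\<^bsub>K\<^esub> \<mu> (g \<otimes>\<^bsub>G\<^esub> h) l = \<mu> g (h \<otimes>\<^bsub>G\<^esub> l) \<otimes>\<^bsub>K\<^esub> \<mu> h l) \<and>
    (\<forall>g \<in> carrier G. \<mu> \<one>\<^bsub>G\<^esub> g = \<one>\<^bsub>K\<^esub> \<and> \<mu> g \<one>\<^bsub>G\<^esub> = \<one>\<^bsub>K\<^esub>)"


section \<open>The cocycle twist\<close>

definition homogeneous_part ::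
    "('k, 'a, 'm) module_scheme \<Rightarrow> ('g, 'n) monoid_scheme \<Rightarrow> ('g \<Rightarrow> 'a \<Rightarrow> 'a) \<Rightarrow>
      ('g \<Rightarrow> 'g \<Rightarrow> 'k) \<Rightarrow> 'g \<Rightarrow> 'a set"
  where "homogeneous_part A G \<phi> \<chi> g =
    {a \<in> carrier A. \<forall>h \<in> carrier G. \<phi> h a = \<chi> (inv\<^bsub>G\<^esub> g) h \<odot>\<^bsub>A\<^esub> a}"

text \<open>\<open>homogeneous_components A G \<phi> \<chi> a g\<close> is the component of \<open>a\<close> of degree \<open>g\<close> in the direct sum
  decomposition of \<open>A\<close> into its homogeneous parts.\<close>

definition homogeneous_components ::
    "('k, 'a, 'm) module_scheme \<Rightarrow> ('g, 'n) monoid_scheme \<Rightarrow> ('g \<Rightarrow> 'a \<Rightarrow> 'a) \<Rightarrow>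
      ('g \<Rightarrow> 'g \<Rightarrow> 'k) \<Rightarrow> 'a \<Rightarrow> 'g \<Rightarrow> 'a"
  where "homogeneous_components A G \<phi> \<chi> a =
    (THE c. c \<in> (\<Pi>\<^sub>E g \<in> carrier G. homogeneous_part A G \<phi> \<chi> g) \<and>
            (\<Oplus>\<^bsub>A\<^esub> g \<in> carrier G. c g) = a)"

text \<open>The bilinear extension of \<open>a * b = \<mu>(g,h) a b\<close> for \<open>a\<close>, \<open>b\<close> homogeneous of degrees \<open>g\<close>, \<open>h\<close>;
  all other operations of \<open>A\<close>, including the unit, are kept.\<close>

definition cocycle_twist ::
    "('k, 'a, 'm) module_scheme \<Rightarrow> ('g, 'n) monoid_scheme \<Rightarrow> ('g \<Rightarrow> 'a \<Rightarrow> 'a) \<Rightarrow>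
      ('g \<Rightarrow> 'g \<Rightarrow> 'k) \<Rightarrow> ('g \<Rightarrow> 'g \<Rightarrow> 'k) \<Rightarrow> ('k, 'a, 'm) module_scheme"
  where "cocycle_twist A G \<phi> \<chi> \<mu> =
    A\<lparr>monoid.mult := (\<lambda>a b. \<Oplus>\<^bsub>A\<^esub> g \<in> carrier G. \<Oplus>\<^bsub>A\<^esub> h \<in> carrier G.
        \<mu> g h \<odot>\<^bsub>A\<^esub> (homogeneous_components A G \<phi> \<chi> a g \<otimes>\<^bsub>A\<^esub> homogeneous_components A G \<phi> \<chi> b h))\<rparr>"


section \<open>The twisted group algebra\<close>

text \<open>For finite \<open>G\<close>, the tensor product of \<open>A\<close> with the group algebra \<open>kG\<close> is the direct sum of
  copies of \<open>A\<close> indexed by \<open>G\<close>: the (extensional) function \<open>x\<close> stands for the sum over \<open>g\<close> of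
  \<open>x g\<close> tensored with \<open>g\<close>. The multiplication is the bilinear extension of the rule for pure
  tensors, see \<open>pure_tensor_mult\<close> below.\<close>

definition twisted_group_algebra ::
    "('k, 'a, 'm) module_scheme \<Rightarrow> ('g, 'n) monoid_scheme \<Rightarrow> ('g \<Rightarrow> 'g \<Rightarrow> 'k) \<Rightarrow>
      ('k, 'g \<Rightarrow> 'a) module"
  where "twisted_group_algebra A G \<mu> =
    \<lparr>carrier = carrier G \<rightarrow>\<^sub>E carrier A,
     monoid.mult = (\<lambda>x y. \<lambda>l \<in> carrier G. \<Oplus>\<^bsub>A\<^esub> g \<in> carrier G. \<Oplus>\<^bsub>A\<^esub> h \<in> {h \<in> carrier G. g \<otimes>\<^bsub>G\<^esub> h = l}.
       \<mu> g h \<odot>\<^bsub>A\<^esub> (x g \<otimes>\<^bsub>A\<^esub> y h)),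
     one = (\<lambda>l \<in> carrier G. if l = \<one>\<^bsub>G\<^esub> then \<one>\<^bsub>A\<^esub> else \<zero>\<^bsub>A\<^esub>),
     ring.zero = (\<lambda>l \<in> carrier G. \<zero>\<^bsub>A\<^esub>),
     ring.add = (\<lambda>x y. \<lambda>l \<in> carrier G. x l \<oplus>\<^bsub>A\<^esub> y l),
     module.smult = (\<lambda>c x. \<lambda>l \<in> carrier G. c \<odot>\<^bsub>A\<^esub> x l)\<rparr>"

definition twisted_action ::
    "('k, 'a, 'm) module_scheme \<Rightarrow> ('g, 'n) monoid_scheme \<Rightarrow> ('g \<Rightarrow> 'a \<Rightarrow> 'a) \<Rightarrow>
      ('g \<Rightarrow> 'g \<Rightarrow> 'k) \<Rightarrow> 'g \<Rightarrow> ('g \<Rightarrow> 'a) \<Rightarrow> 'g \<Rightarrow> 'a"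
  where "twisted_action A G \<phi> \<chi> h x = (\<lambda>g \<in> carrier G. \<chi> g h \<odot>\<^bsub>A\<^esub> \<phi> h (x g))"

definition invariant_subring ::
    "('g, 'n) monoid_scheme \<Rightarrow> ('g \<Rightarrow> 'b \<Rightarrow> 'b) \<Rightarrow> ('k, 'b, 'm) module_scheme \<Rightarrow>
      ('k, 'b, 'm) module_scheme"
  where "invariant_subring G \<psi> B =
    B\<lparr>carrier := {x \<in> carrier B. \<forall>h \<in> carrier G. \<psi> h x = x}\<rparr>"

definition pure_tensor ::
    "('k, 'a, 'm) module_scheme \<Rightarrow> ('g, 'n) monoid_scheme \<Rightarrow> 'a \<Rightarrow> 'g \<Rightarrow> 'g \<Rightarrow> 'a"
  where "pure_tensor A G a g = (\<lambda>l \<in> carrier G. if l = g then a else \<zero>\<^bsub>A\<^esub>)"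

lemma pure_tensor_mult:
  assumes "assoc_algebra K A" "comm_group G" "finite (carrier G)" "normalised_2_cocycle G K \<mu>"
    and "a \<in> carrier A" "b \<in> carrier A" "g \<in> carrier G" "h \<in> carrier G"
  shows "pure_tensor A G a g \<otimes>\<^bsub>twisted_group_algebra A G \<mu>\<^esub> pure_tensor A G b h
    = pure_tensor A G (\<mu> g h \<odot>\<^bsub>A\<^esub> (a \<otimes>\<^bsub>A\<^esub> b)) (g \<otimes>\<^bsub>G\<^esub> h)"
proof -
  interpret A: assoc_algebra K A by fact
  interpret G: comm_group G by fact
  have mu: "\<mu> i j \<in> carrier K" if "i \<in> carrier G" "j \<in> carrier G" for i j
    using assms(4) that by (auto simp: normalised_2_cocycle_def)
  let ?t = "\<mu> g h \<odot>\<^bsub>A\<^esub> (a \<otimes>\<^bsub>A\<^esub> b)"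
  have t: "?t \<in> carrier A" using assms mu by simp
  have "(\<Oplus>\<^bsub>A\<^esub> i \<in> carrier G. \<Oplus>\<^bsub>A\<^esub> j \<in> {j \<in> carrier G. i \<otimes>\<^bsub>G\<^esub> j = l}.
          \<mu> i j \<odot>\<^bsub>A\<^esub> (pure_tensor A G a g i \<otimes>\<^bsub>A\<^esub> pure_tensor A G b h j))
      = (if l = g \<otimes>\<^bsub>G\<^esub> h then ?t else \<zero>\<^bsub>A\<^esub>)" if "l \<in> carrier G" for l
  proof -
    have inner: "(\<Oplus>\<^bsub>A\<^esub> j \<in> {j \<in> carrier G. i \<otimes>\<^bsub>G\<^esub> j = l}.
          \<mu> i j \<odot>\<^bsub>A\<^esub> (pure_tensor A G a g i \<otimes>\<^bsub>A\<^esub> pure_tensor A G b h j))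
       = (if g = i then (if l = g \<otimes>\<^bsub>G\<^esub> h then ?t else \<zero>\<^bsub>A\<^esub>) else \<zero>\<^bsub>A\<^esub>)"
      if i: "i \<in> carrier G" for i
    proof -
      have "(\<Oplus>\<^bsub>A\<^esub> j \<in> {j \<in> carrier G. i \<otimes>\<^bsub>G\<^esub> j = l}.
          \<mu> i j \<odot>\<^bsub>A\<^esub> (pure_tensor A G a g i \<otimes>\<^bsub>A\<^esub> pure_tensor A G b h j))
        = (\<Oplus>\<^bsub>A\<^esub> j \<in> {j \<in> carrier G. i \<otimes>\<^bsub>G\<^esub> j = l}. if h = j then (if g = i then ?t else \<zero>\<^bsub>A\<^esub>) else \<zero>\<^bsub>A\<^esub>)"
        using i t assms mu by (intro A.finsum_cong') (auto simp: pure_tensor_def)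
      also have "\<dots> = (if g = i then (if l = g \<otimes>\<^bsub>G\<^esub> h then ?t else \<zero>\<^bsub>A\<^esub>) else \<zero>\<^bsub>A\<^esub>)"
      proof (cases "h \<in> {j \<in> carrier G. i \<otimes>\<^bsub>G\<^esub> j = l}")
        case True
        have "(\<Oplus>\<^bsub>A\<^esub> j \<in> {j \<in> carrier G. i \<otimes>\<^bsub>G\<^esub> j = l}. if h = j then (if g = i then ?t else \<zero>\<^bsub>A\<^esub>) else \<zero>\<^bsub>A\<^esub>)
          = (if g = i then ?t else \<zero>\<^bsub>A\<^esub>)"
          using assms(3) t
          by (intro A.finsum_singleton[OF True, of "\<lambda>_. if g = i then ?t else \<zero>\<^bsub>A\<^esub>"]) auto
        also have "\<dots> = (if g = i then (if l = g \<otimes>\<^bsub>G\<^esub> h then ?t else \<zero>\<^bsub>A\<^esub>) else \<zero>\<^bsub>A\<^esub>)"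
          using True by auto
        finally show ?thesis .
      next
        case False
        have "(\<Oplus>\<^bsub>A\<^esub> j \<in> {j \<in> carrier G. i \<otimes>\<^bsub>G\<^esub> j = l}. if h = j then (if g = i then ?t else \<zero>\<^bsub>A\<^esub>) else \<zero>\<^bsub>A\<^esub>)
          = (\<Oplus>\<^bsub>A\<^esub> j \<in> {j \<in> carrier G. i \<otimes>\<^bsub>G\<^esub> j = l}. \<zero>\<^bsub>A\<^esub>)"
          using False t by (intro A.finsum_cong') auto
        then show ?thesis using False assms by auto
      qed
      finally show ?thesis .
    qed
    have "(\<Oplus>\<^bsub>A\<^esub> i \<in> carrier G. \<Oplus>\<^bsub>A\<^esub> j \<in> {j \<in> carrier G. i \<otimes>\<^bsub>G\<^esub> j = l}.
          \<mu> i j \<odot>\<^bsub>A\<^esub> (pure_tensor A G a g i \<otimes>\<^bsub>A\<^esub> pure_tensor A G b h j))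
       = (\<Oplus>\<^bsub>A\<^esub> i \<in> carrier G. if g = i then (if l = g \<otimes>\<^bsub>G\<^esub> h then ?t else \<zero>\<^bsub>A\<^esub>) else \<zero>\<^bsub>A\<^esub>)"
      using inner t by (intro A.finsum_cong') auto
    also have "\<dots> = (if l = g \<otimes>\<^bsub>G\<^esub> h then ?t else \<zero>\<^bsub>A\<^esub>)"
      using A.finsum_singleton[OF assms(7,3), of "\<lambda>_. if l = g \<otimes>\<^bsub>G\<^esub> h then ?t else \<zero>\<^bsub>A\<^esub>"] t by auto
    finally show ?thesis .
  qed
  then show ?thesis
    by (auto simp: twisted_group_algebra_def pure_tensor_def[of A G ?t] fun_eq_iff restrict_def)
qed

lemma twisted_action_pure_tensor:
  assumes "assoc_algebra K A" "acts_by_alg_auts K A G \<phi>" "h \<in> carrier G" "g \<in> carrier G"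
    and "\<chi> \<in> carrier G \<rightarrow> carrier (character_group G K)"
  shows "twisted_action A G \<phi> \<chi> h (pure_tensor A G a g)
    = (\<lambda>l \<in> carrier G. \<chi> g h \<odot>\<^bsub>A\<^esub> pure_tensor A G (\<phi> h a) g l)"
proof -
  interpret A: assoc_algebra K A by fact
  have "\<phi> h \<in> ring_hom A A"
    using assms(2,3) by (auto simp: acts_by_alg_auts_def alg_iso_def ring_iso_def)
  then have z: "\<phi> h \<zero>\<^bsub>A\<^esub> = \<zero>\<^bsub>A\<^esub>"
    using ring_hom_zero assoc_algebra.axioms(2)[OF assms(1)] by blast
  have "\<chi> l h \<in> carrier K" if "l \<in> carrier G" for l
    using assms(3,5) that by (auto simp: character_group_def hom_def Pi_iff)
  then show ?thesis
    using z assms(4) by (auto simp: twisted_action_def pure_tensor_def fun_eq_iff restrict_def)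
qed

end

theory Submission
  imports Defs
begin

text \<open>An element \<open>\<Sum>g. x g \<otimes> g\<close> of the twisted group algebra is invariant iff every \<open>x g\<close> is homogeneous
  of degree \<open>g\<close>, because the character by which \<open>G\<close> acts on the second factor cancels the one
  defining \<open>A\<^sub>g\<close>. Hence \<open>\<Sum>g. x g \<otimes> g \<mapsto> \<Sum>g. x g\<close> maps the invariants multiplicatively to the cocycle
  twist. It is bijective since \<open>A\<close> is the direct sum of its homogeneous parts: by the two
  orthogonality relations for characters, \<open>a \<mapsto> |G|\<^sup>-\<^sup>1 \<Sum>h. \<chi>\<^sub>g(h) a\<^sup>h\<close> is the projection to
  degree \<open>g\<close>. The algebra axioms for the twist are then transported along this bijection.\<close>

text \<open>The two orthogonality relations do different jobs. Summing over the group shows that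
  \<open>proj\<close> recovers each member of a homogeneous decomposition from its sum, hence
  uniqueness; summing over the characters shows that the projections of an element add up to it,
  hence existence. The first relation comes from the injectivity of \<chi>. The second needs that
  the characters separate the points of G, and this is the real obstacle: the isomorphism of G with
  its character group says so only indirectly, through the number of characters, and a dimension
  count has to turn that into a statement about values. The product of the twist is written with
  components chosen by \<open>THE\<close>, whereas the product of the twisted group algebra is an
  explicit convolution. So the algebra axioms are proved for the convolution, where associativity
  rests on the cocycle identity and the unit laws on normalisation.\<close>

section \<open>Finite sums\<close>

lemma (in abelian_monoid) finsum_swap:
  assumes "finite I" "finite J" "\<And>i j. \<lbrakk>i \<in> I; j \<in> J\<rbrakk> \<Longrightarrow> f i j \<in> carrier G"
  shows "(\<Oplus>i \<in> I. \<Oplus>j \<in> J. f i j) = (\<Oplus>j \<in> J. \<Oplus>i \<in> I. f i j)"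
  using assms(1,3)
proof (induction I rule: finite_induct)
  case empty
  then show ?case by (simp add: finsum_zero)
next
  case (insert i I)
  have "(\<Oplus>i' \<in> insert i I. \<Oplus>j \<in> J. f i' j) = (\<Oplus>j \<in> J. f i j) \<oplus> (\<Oplus>j \<in> J. \<Oplus>i' \<in> I. f i' j)"
    using insert by (subst finsum_insert) (auto intro!: finsum_closed)
  also have "\<dots> = (\<Oplus>j \<in> J. f i j \<oplus> (\<Oplus>i' \<in> I. f i' j))"
    using insert by (subst finsum_addf) (auto intro!: finsum_closed)
  also have "\<dots> = (\<Oplus>j \<in> J. \<Oplus>i' \<in> insert i I. f i' j)"
    using insert by (intro finsum_cong') (auto intro!: finsum_closed finsum_insert[symmetric])
  finally show ?case .
qed

text \<open>Left multiplication by c permutes the group. This drives the averaging arguments for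
  characters and the changes of variable in convolution sums.\<close>

lemma (in abelian_monoid) finsum_translate:
  assumes "group H" "c \<in> carrier H" "\<And>h. h \<in> carrier H \<Longrightarrow> f h \<in> carrier G"
  shows "(\<Oplus>h \<in> carrier H. f (c \<otimes>\<^bsub>H\<^esub> h)) = (\<Oplus>h \<in> carrier H. f h)"
proof -
  interpret H: group H by fact
  have "(\<Oplus>h \<in> carrier H. f (c \<otimes>\<^bsub>H\<^esub> h)) = (\<Oplus>h \<in> (\<lambda>h. c \<otimes>\<^bsub>H\<^esub> h) ` carrier H. f h)"
    using assms(2,3) by (intro finsum_reindex[symmetric]) (auto simp: inj_on_def)
  then show ?thesis using H.surj_const_mult[OF assms(2)] by simp
qed

lemma (in module) finsum_smult_rdistr:
  assumes "finite I" "\<And>i. i \<in> I \<Longrightarrow> c i \<in> carrier R" "a \<in> carrier M"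
  shows "(\<Oplus>\<^bsub>M\<^esub> i \<in> I. c i \<odot>\<^bsub>M\<^esub> a) = (\<Oplus>i \<in> I. c i) \<odot>\<^bsub>M\<^esub> a"
  using assms by (induction I rule: finite_induct) (auto simp: smult_l_distr Pi_iff)

text \<open>Gaussian elimination, one row and one unknown at a time: a nonzero entry of row k
  removes its unknown from the other rows, the smaller system is solved by induction, and row k then
  fixes the removed unknown.\<close>

lemma (in field) ex_nontrivial_solution:
  assumes "finite I" "finite J" "card I < card J"
    and "\<And>i j. \<lbrakk>i \<in> I; j \<in> J\<rbrakk> \<Longrightarrow> a i j \<in> carrier R"
  shows "\<exists>c \<in> J \<rightarrow> carrier R. (\<exists>j \<in> J. c j \<noteq> \<zero>) \<and> (\<forall>i \<in> I. (\<Oplus>j \<in> J. a i j \<otimes> c j) = \<zero>)"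
  using assms
proof (induction I arbitrary: J a rule: finite_induct)
  case empty
  then obtain j where "j \<in> J" by fastforce
  then show ?case by (intro bexI[of _ "\<lambda>_. \<one>"]) auto
next
  case (insert k I)
  show ?case
  proof (cases "\<forall>j \<in> J. a k j = \<zero>")
    \<comment> \<open>A zero row holds for every c, so the remaining rows can be solved
      alone.\<close>
    case True
    have "\<exists>c \<in> J \<rightarrow> carrier R. (\<exists>j \<in> J. c j \<noteq> \<zero>) \<and> (\<forall>i \<in> I. (\<Oplus>j \<in> J. a i j \<otimes> c j) = \<zero>)"
      using insert by (intro insert.IH) auto
    then obtain c where c: "c \<in> J \<rightarrow> carrier R" "\<exists>j \<in> J. c j \<noteq> \<zero>"
      "\<forall>i \<in> I. (\<Oplus>j \<in> J. a i j \<otimes> c j) = \<zero>" by blast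
    have "(\<Oplus>j \<in> J. a k j \<otimes> c j) = (\<Oplus>j \<in> J. \<zero>)"
      using True c by (intro finsum_cong') (auto simp: Pi_iff)
    then show ?thesis using c by (auto simp: finsum_zero)
  next
    case False
    then obtain p where p: "p \<in> J" "a k p \<noteq> \<zero>" by blast
    define u where "u = inv (a k p)"
    have ak: "a k j \<in> carrier R" if "j \<in> J" for j using insert.prems(3) that by auto
    have ai: "a i j \<in> carrier R" if "j \<in> J" "i \<in> I" for i j using insert.prems(3) that by auto
    have u: "u \<in> carrier R" "a k p \<otimes> u = \<one>"
      using p ak by (auto simp: u_def field_Units)
    define J' where "J' = J - {p}"
    have J': "finite J'" "p \<notin> J'" "J = insert p J'" using p insert.prems by (auto simp: J'_def)
    \<comment> \<open>Row i minus the multiple of row k that clears column p.\<close>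
    define b where "b i j = a i j \<ominus> a i p \<otimes> u \<otimes> a k j" for i j
    have "\<exists>c \<in> J' \<rightarrow> carrier R. (\<exists>j \<in> J'. c j \<noteq> \<zero>) \<and> (\<forall>i \<in> I. (\<Oplus>j \<in> J'. b i j \<otimes> c j) = \<zero>)"
      using insert.prems insert.hyps J' u ak ai by (intro insert.IH) (auto simp: b_def)
    then obtain c where c: "c \<in> J' \<rightarrow> carrier R" "\<exists>j \<in> J'. c j \<noteq> \<zero>"
      "\<And>i. i \<in> I \<Longrightarrow> (\<Oplus>j \<in> J'. b i j \<otimes> c j) = \<zero>" by blast
    define S where "S i = (\<Oplus>j \<in> J'. a i j \<otimes> c j)" for i
    have S: "S i \<in> carrier R" if "i \<in> insert k I" for i
      unfolding S_def using that c J' insert.prems(3) by (intro finsum_closed) auto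
    \<comment> \<open>The value at p is forced by row k: \<open>a k p \<otimes> d p\<close> must
      cancel \<open>S k\<close>.\<close>
    define d where "d = c(p := \<ominus> (u \<otimes> S k))"
    have d: "d \<in> J \<rightarrow> carrier R" using c J' u S[of k] by (auto simp: d_def)
    have sum_d: "(\<Oplus>j \<in> J. a i j \<otimes> d j) = S i \<ominus> a i p \<otimes> u \<otimes> S k" if i: "i \<in> insert k I" for i
    proof -
      have "(\<Oplus>j \<in> J. a i j \<otimes> d j) = a i p \<otimes> d p \<oplus> (\<Oplus>j \<in> J'. a i j \<otimes> d j)"
        unfolding J'(3) using i J' d insert.prems(3) by (intro finsum_insert) auto
      also have "(\<Oplus>j \<in> J'. a i j \<otimes> d j) = S i"
        unfolding S_def using i J' c insert.prems(3) by (intro finsum_cong') (auto simp: d_def)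
      also have "a i p \<otimes> d p \<oplus> S i = S i \<ominus> a i p \<otimes> u \<otimes> S k"
        using i u S[of k] S[OF i] p insert.prems(3)[OF i p(1)] unfolding d_def by simp algebra
      finally show ?thesis .
    qed
    have "S i \<ominus> a i p \<otimes> u \<otimes> S k = \<zero>" if i: "i \<in> I" for i
    proof -
      have "\<zero> = (\<Oplus>j \<in> J'. a i j \<otimes> c j \<oplus> (\<ominus> (a i p \<otimes> u)) \<otimes> (a k j \<otimes> c j))"
        unfolding c(3)[OF i, symmetric]
      proof (intro finsum_cong' refl)
        fix j assume j: "j \<in> J'"
        have "a i j \<in> carrier R" "a k j \<in> carrier R" "a i p \<in> carrier R" "c j \<in> carrier R"
          using j i p c ai ak J' by auto
        then show "b i j \<otimes> c j = a i j \<otimes> c j \<oplus> (\<ominus> (a i p \<otimes> u)) \<otimes> (a k j \<otimes> c j)"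
          unfolding b_def using u(1) by algebra
      qed (use i p c ai ak J' u in \<open>auto simp: Pi_iff\<close>)
      also have "\<dots> = S i \<oplus> (\<Oplus>j \<in> J'. (\<ominus> (a i p \<otimes> u)) \<otimes> (a k j \<otimes> c j))"
        unfolding S_def using i p c ai ak J' u by (intro finsum_addf) (auto simp: Pi_iff)
      also have "(\<Oplus>j \<in> J'. (\<ominus> (a i p \<otimes> u)) \<otimes> (a k j \<otimes> c j)) = (\<ominus> (a i p \<otimes> u)) \<otimes> S k"
        unfolding S_def using i p c ai ak J' u by (intro finsum_rdistr[symmetric]) (auto simp: Pi_iff)
      also have "S i \<oplus> (\<ominus> (a i p \<otimes> u)) \<otimes> S k = S i \<ominus> a i p \<otimes> u \<otimes> S k"
        using i u S[of i] S[of k] p ai[of p i] by (simp add: l_minus minus_eq)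
      finally show ?thesis by simp
    qed
    moreover have "S k \<ominus> a k p \<otimes> u \<otimes> S k = \<zero>"
      using u S[of k] by (simp add: minus_eq r_neg)
    ultimately have "\<forall>i \<in> insert k I. (\<Oplus>j \<in> J. a i j \<otimes> d j) = \<zero>"
      using sum_d by auto
    moreover have "\<exists>j \<in> J. d j \<noteq> \<zero>" using c(2) J' by (auto simp: d_def)
    ultimately show ?thesis using d by blast
  qed
qed

section \<open>Associative algebras\<close>

text \<open>Zero and negatives lie in S as the multiples of its elements by the scalars 0 and
  -1.\<close>

lemma (in assoc_algebra) subalgebra:
  assumes "S \<subseteq> carrier M" "\<one>\<^bsub>M\<^esub> \<in> S"
    and "\<And>x y. \<lbrakk>x \<in> S; y \<in> S\<rbrakk> \<Longrightarrow> x \<oplus>\<^bsub>M\<^esub> y \<in> S"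
    and "\<And>x y. \<lbrakk>x \<in> S; y \<in> S\<rbrakk> \<Longrightarrow> x \<otimes>\<^bsub>M\<^esub> y \<in> S"
    and smult: "\<And>c x. \<lbrakk>c \<in> carrier R; x \<in> S\<rbrakk> \<Longrightarrow> c \<odot>\<^bsub>M\<^esub> x \<in> S"
  shows "assoc_algebra R (M\<lparr>carrier := S\<rparr>)"
proof -
  note S = subsetD[OF assms(1)]
  have zero: "\<zero>\<^bsub>M\<^esub> \<in> S" using smult[of \<zero> "\<one>\<^bsub>M\<^esub>"] assms(2) by simp
  have neg: "\<ominus>\<^bsub>M\<^esub> x \<in> S" if "x \<in> S" for x
    using smult[of "\<ominus> \<one>" x] that S[OF that] by (simp add: smult_l_minus)
  have "ring (M\<lparr>carrier := S\<rparr>)"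
  proof (rule ringI)
    have "\<exists>y \<in> S. y \<oplus>\<^bsub>M\<^esub> x = \<zero>\<^bsub>M\<^esub>" if "x \<in> S" for x
      using neg[OF that] M.l_neg[OF S[OF that]] by blast
    then show "abelian_group (M\<lparr>carrier := S\<rparr>)"
      using assms S zero by (intro abelian_groupI) (auto simp: M.a_assoc intro: M.a_comm)
    show "monoid (M\<lparr>carrier := S\<rparr>)"
      using assms S by (intro monoidI) (auto simp: m_assoc)
  qed (use S in \<open>auto simp: l_distr r_distr\<close>)
  then show ?thesis
    using assms S
    by (intro assoc_algebra.intro module.intro module_axioms.intro assoc_algebra_axioms.intro)
      (auto simp: smult_l_distr smult_r_distr smult_assoc1 smult_mult_left smult_mult_right
        R.is_cring ring.is_abelian_group)
qed

text \<open>Each axiom is an identity, or the existence of an inverse, between elements of the form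
  f x, and so follows from the same axiom in B. Nothing is presupposed about A as a ring, which
  allows its structure to be derived from that of B.\<close>

lemma assoc_algebra_hom_image:
  fixes R :: "('k, 'l) ring_scheme"
  assumes "assoc_algebra R B" "f ` carrier B = carrier A"
    and add: "\<And>x y. \<lbrakk>x \<in> carrier B; y \<in> carrier B\<rbrakk> \<Longrightarrow> f (x \<oplus>\<^bsub>B\<^esub> y) = f x \<oplus>\<^bsub>A\<^esub> f y"
    and mult: "\<And>x y. \<lbrakk>x \<in> carrier B; y \<in> carrier B\<rbrakk> \<Longrightarrow> f (x \<otimes>\<^bsub>B\<^esub> y) = f x \<otimes>\<^bsub>A\<^esub> f y"
    and smult: "\<And>c x. \<lbrakk>c \<in> carrier R; x \<in> carrier B\<rbrakk> \<Longrightarrow> f (c \<odot>\<^bsub>B\<^esub> x) = c \<odot>\<^bsub>A\<^esub> f x"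
    and one: "f \<one>\<^bsub>B\<^esub> = \<one>\<^bsub>A\<^esub>" and zero: "f \<zero>\<^bsub>B\<^esub> = \<zero>\<^bsub>A\<^esub>"
  shows "assoc_algebra R A"
proof -
  interpret B: assoc_algebra R B by fact
  have im: "\<exists>x' \<in> carrier B. x = f x'" if "x \<in> carrier A" for x using that assms(2) by blast
  have cl: "f x \<in> carrier A" if "x \<in> carrier B" for x using that assms(2) by blast
  \<comment> \<open>Read from right to left, these rules gather an expression over images into a
    single f applied to an expression in B.\<close>
  note hom = add[symmetric] mult[symmetric] smult[symmetric] one[symmetric] zero[symmetric]
  have ag: "abelian_group A"
  proof (rule abelian_groupI)
    fix x assume "x \<in> carrier A"
    then obtain x' where x': "x' \<in> carrier B" "x = f x'" using im by blast
    then have "f (\<ominus>\<^bsub>B\<^esub> x') \<oplus>\<^bsub>A\<^esub> x = \<zero>\<^bsub>A\<^esub>" by (simp add: hom B.M.l_neg)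
    then show "\<exists>y \<in> carrier A. y \<oplus>\<^bsub>A\<^esub> x = \<zero>\<^bsub>A\<^esub>" using x' cl by blast
  qed (auto dest!: im simp: hom cl B.M.a_ac)
  moreover have "monoid A"
    by (rule monoidI) (auto dest!: im simp: hom cl B.m_assoc)
  ultimately have "ring A"
    by (rule ringI) (auto dest!: im simp: hom cl B.l_distr B.r_distr)
  with ag show ?thesis
    by (intro assoc_algebra.intro module.intro module_axioms.intro assoc_algebra_axioms.intro)
      (auto dest!: im simp: hom cl B.smult_l_distr B.smult_r_distr B.smult_assoc1
        B.smult_mult_left B.smult_mult_right B.R.is_cring)
qed

section \<open>Orthogonality of characters\<close>

text \<open>Division with remainder: if n kills 1, so does its remainder modulo the least positive
  number that does. Minimality makes the remainder 0, so the characteristic divides n.\<close>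

lemma (in field) add_pow_one_nonzero:
  assumes "\<not> ring_char R dvd n"
  shows "add_pow R n \<one> \<noteq> \<zero>"
proof
  assume n: "add_pow R n \<one> = \<zero>"
  let ?P = "\<lambda>m::nat. m > 0 \<and> add_pow R m \<one> = \<zero>"
  have "n > 0" using assms by (cases n) auto
  with n have "?P n" by blast
  define c where "c = (LEAST m. ?P m)"
  have "\<exists>m>0. add_pow R (m::nat) \<one> = \<zero>" using \<open>?P n\<close> by blast
  then have char: "ring_char R = c" unfolding ring_char_def c_def by (rule if_P)
  have c: "?P c" unfolding c_def using \<open>?P n\<close> by (rule LeastI)
  have mult: "add_pow R (c * (n div c)) \<one> = \<zero>"
    using c add.nat_pow_pow[of \<one> "n div c" c] by simp
  have "add_pow R (c * (n div c) + n mod c) \<one> = add_pow R (n mod c) \<one>"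
    using mult add.nat_pow_mult[of \<one> "c * (n div c)" "n mod c"] by simp
  then have "add_pow R (n mod c) \<one> = \<zero>" using n by simp
  moreover have "n mod c < c" using c by simp
  ultimately have "n mod c = 0"
    using not_less_Least[of "n mod c" ?P] by (auto simp: c_def)
  then show False using assms char by auto
qed

locale self_dual_group = K: field K + G: comm_group G
  for K :: "('k, 'l) ring_scheme" and G :: "('g, 'n) monoid_scheme" +
  fixes \<chi> :: "'g \<Rightarrow> 'g \<Rightarrow> 'k"
  assumes finite_G: "finite (carrier G)"
    and char_ndvd: "\<not> ring_char K dvd order G"
    and chi_iso: "\<chi> \<in> iso G (character_group G K)"
begin

section \<open>Values of the characters\<close>

lemma chi_char: "g \<in> carrier G \<Longrightarrow> \<chi> g \<in> hom G (mult_of K) \<inter> extensional (carrier G)"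
  using chi_iso by (auto simp: iso_def hom_def character_group_def Pi_iff)

lemma chi_closed [simp]: "\<lbrakk>g \<in> carrier G; x \<in> carrier G\<rbrakk> \<Longrightarrow> \<chi> g x \<in> carrier K"
  and chi_nonzero: "\<lbrakk>g \<in> carrier G; x \<in> carrier G\<rbrakk> \<Longrightarrow> \<chi> g x \<noteq> \<zero>\<^bsub>K\<^esub>"
  using chi_char[of g] by (auto simp: hom_def Pi_iff)

lemma chi_mult_right:
  "\<lbrakk>g \<in> carrier G; x \<in> carrier G; y \<in> carrier G\<rbrakk> \<Longrightarrow> \<chi> g (x \<otimes>\<^bsub>G\<^esub> y) = \<chi> g x \<otimes>\<^bsub>K\<^esub> \<chi> g y"
  using chi_char[of g] by (auto simp: hom_def)

lemma chi_mult_left: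
  "\<lbrakk>g \<in> carrier G; h \<in> carrier G; x \<in> carrier G\<rbrakk> \<Longrightarrow> \<chi> (g \<otimes>\<^bsub>G\<^esub> h) x = \<chi> g x \<otimes>\<^bsub>K\<^esub> \<chi> h x"
  using chi_iso by (auto simp: iso_def hom_def character_group_def)

text \<open>Multiplicativity makes the value of a character at the identity a nonzero idempotent,
  which cancellation identifies as 1; the same holds for the values of the character of the
  identity.\<close>

lemma idem_one: "\<lbrakk>a \<in> carrier K; a \<noteq> \<zero>\<^bsub>K\<^esub>; a \<otimes>\<^bsub>K\<^esub> a = a\<rbrakk> \<Longrightarrow> a = \<one>\<^bsub>K\<^esub>"
  using K.m_lcancel[of a a "\<one>\<^bsub>K\<^esub>"] by simp

lemma chi_one_right [simp]: "g \<in> carrier G \<Longrightarrow> \<chi> g \<one>\<^bsub>G\<^esub> = \<one>\<^bsub>K\<^esub>"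
  using chi_mult_right[of g "\<one>\<^bsub>G\<^esub>" "\<one>\<^bsub>G\<^esub>"] chi_nonzero by (intro idem_one) auto

lemma chi_one_left [simp]: "x \<in> carrier G \<Longrightarrow> \<chi> \<one>\<^bsub>G\<^esub> x = \<one>\<^bsub>K\<^esub>"
  using chi_mult_left[of "\<one>\<^bsub>G\<^esub>" "\<one>\<^bsub>G\<^esub>" x] chi_nonzero by (intro idem_one) auto

lemma chi_inv_mult [simp]:
  "\<lbrakk>g \<in> carrier G; x \<in> carrier G\<rbrakk> \<Longrightarrow> \<chi> (inv\<^bsub>G\<^esub> g) x \<otimes>\<^bsub>K\<^esub> \<chi> g x = \<one>\<^bsub>K\<^esub>"
  "\<lbrakk>g \<in> carrier G; x \<in> carrier G\<rbrakk> \<Longrightarrow> \<chi> g x \<otimes>\<^bsub>K\<^esub> \<chi> (inv\<^bsub>G\<^esub> g) x = \<one>\<^bsub>K\<^esub>"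
  by (simp_all flip: chi_mult_left)

text \<open>By injectivity of \<chi>: the trivial character is already that of the identity.
  Extensionality turns agreement on the carrier into equality of functions.\<close>

lemma chi_nontrivial:
  assumes "g \<in> carrier G" "g \<noteq> \<one>\<^bsub>G\<^esub>"
  shows "\<exists>x \<in> carrier G. \<chi> g x \<noteq> \<one>\<^bsub>K\<^esub>"
proof (rule ccontr)
  assume "\<not> ?thesis"
  then have "\<chi> g = \<chi> \<one>\<^bsub>G\<^esub>"
    using chi_char[OF assms(1)] chi_char[OF G.one_closed]
    by (intro extensionalityI[of _ "carrier G"]) auto
  moreover have "inj_on \<chi> (carrier G)" using chi_iso by (auto simp: iso_def bij_betw_def)
  ultimately show False using assms by (auto dest: inj_onD)
qed

definition order_K :: 'k where "order_K = add_pow K (order G) \<one>\<^bsub>K\<^esub>"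

lemma order_K_closed [simp]: "order_K \<in> carrier K"
  by (simp add: order_K_def)

lemma order_K_nonzero: "order_K \<noteq> \<zero>\<^bsub>K\<^esub>"
  unfolding order_K_def using char_ndvd by (rule K.add_pow_one_nonzero)

lemma finsum_one: "(\<Oplus>\<^bsub>K\<^esub> x \<in> carrier G. \<one>\<^bsub>K\<^esub>) = order_K"
  by (simp add: order_K_def order_def K.add.finprod_const)

text \<open>Translating the summation variable by y multiplies the sum by \<open>\<chi> g y\<close>
  and also leaves it unchanged. For a nontrivial character some y has a value other than 1, so the
  sum vanishes.\<close>

lemma sum_chi_over_group:
  assumes g: "g \<in> carrier G"
  shows "(\<Oplus>\<^bsub>K\<^esub> x \<in> carrier G. \<chi> g x) = (if g = \<one>\<^bsub>G\<^esub> then order_K else \<zero>\<^bsub>K\<^esub>)"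
proof (cases "g = \<one>\<^bsub>G\<^esub>")
  case True
  have "(\<Oplus>\<^bsub>K\<^esub> x \<in> carrier G. \<chi> g x) = (\<Oplus>\<^bsub>K\<^esub> x \<in> carrier G. \<one>\<^bsub>K\<^esub>)"
    using True by (intro K.finsum_cong') auto
  then show ?thesis using True finsum_one by simp
next
  case False
  then obtain y where y: "y \<in> carrier G" "\<chi> g y \<noteq> \<one>\<^bsub>K\<^esub>" using chi_nontrivial g by blast
  let ?S = "\<Oplus>\<^bsub>K\<^esub> x \<in> carrier G. \<chi> g x"
  have S: "?S \<in> carrier K" using g by (intro K.finsum_closed) auto
  have "\<chi> g y \<otimes>\<^bsub>K\<^esub> ?S = (\<Oplus>\<^bsub>K\<^esub> x \<in> carrier G. \<chi> g (y \<otimes>\<^bsub>G\<^esub> x))"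
    using g y finite_G by (subst K.finsum_rdistr) (auto simp: chi_mult_right intro!: K.finsum_cong')
  also have "\<dots> = ?S" using g y by (intro K.finsum_translate[OF G.is_group]) auto
  finally have "\<chi> g y \<otimes>\<^bsub>K\<^esub> ?S = \<one>\<^bsub>K\<^esub> \<otimes>\<^bsub>K\<^esub> ?S" using S by simp
  then have "?S = \<zero>\<^bsub>K\<^esub>" using S g y K.m_rcancel[of ?S "\<chi> g y" "\<one>\<^bsub>K\<^esub>"] by auto
  then show ?thesis using False by simp
qed

text \<open>If all characters were trivial at \<open>h \<noteq> \<one>\<close>, a linear relation between the characters on
  \<open>G - {h}\<close> would extend to \<open>G\<close>. Since there are \<open>|G|\<close> characters, a nontrivial such relation exists
  by counting; it contradicts the linear independence given by \<open>sum_chi_over_group\<close>.\<close>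

lemma characters_separate_points:
  assumes h: "h \<in> carrier G" "h \<noteq> \<one>\<^bsub>G\<^esub>"
  shows "\<exists>g \<in> carrier G. \<chi> g h \<noteq> \<one>\<^bsub>K\<^esub>"
proof (rule ccontr)
  assume triv: "\<not> ?thesis"
  \<comment> \<open>A linear system with one unknown per character and one equation per point other
    than h: one equation short.\<close>
  have "\<exists>c \<in> carrier G \<rightarrow> carrier K. (\<exists>g \<in> carrier G. c g \<noteq> \<zero>\<^bsub>K\<^esub>) \<and>
      (\<forall>x \<in> carrier G - {h}. (\<Oplus>\<^bsub>K\<^esub> g \<in> carrier G. \<chi> g x \<otimes>\<^bsub>K\<^esub> c g) = \<zero>\<^bsub>K\<^esub>)"
    using finite_G h by (intro K.ex_nontrivial_solution card_Diff1_less) auto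
  then obtain c k where c: "c \<in> carrier G \<rightarrow> carrier K" and k: "k \<in> carrier G" "c k \<noteq> \<zero>\<^bsub>K\<^esub>"
    and rel: "\<And>x. x \<in> carrier G - {h} \<Longrightarrow> (\<Oplus>\<^bsub>K\<^esub> g \<in> carrier G. \<chi> g x \<otimes>\<^bsub>K\<^esub> c g) = \<zero>\<^bsub>K\<^esub>"
    by blast
  have c': "c g \<in> carrier K" if "g \<in> carrier G" for g using c that by auto
  \<comment> \<open>The omitted equation at h coincides with the one at the identity, since all
    coefficients of both are 1.\<close>
  have "(\<Oplus>\<^bsub>K\<^esub> g \<in> carrier G. \<chi> g h \<otimes>\<^bsub>K\<^esub> c g) = (\<Oplus>\<^bsub>K\<^esub> g \<in> carrier G. \<chi> g \<one>\<^bsub>G\<^esub> \<otimes>\<^bsub>K\<^esub> c g)"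
    using triv c' by (intro K.finsum_cong') auto
  with rel h have rel': "(\<Oplus>\<^bsub>K\<^esub> g \<in> carrier G. \<chi> g x \<otimes>\<^bsub>K\<^esub> c g) = \<zero>\<^bsub>K\<^esub>" if "x \<in> carrier G" for x
    using that by (cases "x = h") auto
  \<comment> \<open>Pairing the relation with the inverse of the character of k isolates the
    coefficient \<open>c k\<close>, multiplied by the order of G.\<close>
  have "\<zero>\<^bsub>K\<^esub> = (\<Oplus>\<^bsub>K\<^esub> x \<in> carrier G. \<chi> (inv\<^bsub>G\<^esub> k) x \<otimes>\<^bsub>K\<^esub> (\<Oplus>\<^bsub>K\<^esub> g \<in> carrier G. \<chi> g x \<otimes>\<^bsub>K\<^esub> c g))"
    using k rel' by (intro K.add.finprod_one_eqI[symmetric]) auto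
  also have "\<dots> = (\<Oplus>\<^bsub>K\<^esub> x \<in> carrier G. \<Oplus>\<^bsub>K\<^esub> g \<in> carrier G. \<chi> (inv\<^bsub>G\<^esub> k \<otimes>\<^bsub>G\<^esub> g) x \<otimes>\<^bsub>K\<^esub> c g)"
    using k c' finite_G
    by (auto simp: K.finsum_rdistr chi_mult_left K.m_assoc Pi_iff
        intro!: K.finsum_cong' K.finsum_closed)
  also have "\<dots> = (\<Oplus>\<^bsub>K\<^esub> g \<in> carrier G. \<Oplus>\<^bsub>K\<^esub> x \<in> carrier G. \<chi> (inv\<^bsub>G\<^esub> k \<otimes>\<^bsub>G\<^esub> g) x \<otimes>\<^bsub>K\<^esub> c g)"
    using k c' finite_G by (intro K.finsum_swap) auto
  also have "\<dots> = (\<Oplus>\<^bsub>K\<^esub> g \<in> carrier G. if k = g then order_K \<otimes>\<^bsub>K\<^esub> c g else \<zero>\<^bsub>K\<^esub>)"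
  proof (intro K.finsum_cong' refl)
    fix g assume g: "g \<in> carrier G"
    have "inv\<^bsub>G\<^esub> k \<otimes>\<^bsub>G\<^esub> g = \<one>\<^bsub>G\<^esub> \<longleftrightarrow> k = g"
      using g k(1) by (metis G.inv_closed G.inv_equality G.inv_inv G.l_inv)
    then show "(\<Oplus>\<^bsub>K\<^esub> x \<in> carrier G. \<chi> (inv\<^bsub>G\<^esub> k \<otimes>\<^bsub>G\<^esub> g) x \<otimes>\<^bsub>K\<^esub> c g) =
        (if k = g then order_K \<otimes>\<^bsub>K\<^esub> c g else \<zero>\<^bsub>K\<^esub>)"
      using g k(1) c' finite_G by (subst K.finsum_ldistr[symmetric]) (auto simp: sum_chi_over_group)
  qed (use c' in auto)
  also have "\<dots> = order_K \<otimes>\<^bsub>K\<^esub> c k"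
    using k c' finite_G by (intro K.finsum_singleton) auto
  finally show False using k c' order_K_nonzero K.integral[of order_K "c k"] by auto
qed

text \<open>The averaging argument with the roles exchanged: now the index is translated by some y
  with \<open>\<chi> y h\<close> different from 1, which exists because the characters separate
  points.\<close>

lemma sum_chi_over_characters:
  assumes h: "h \<in> carrier G"
  shows "(\<Oplus>\<^bsub>K\<^esub> g \<in> carrier G. \<chi> g h) = (if h = \<one>\<^bsub>G\<^esub> then order_K else \<zero>\<^bsub>K\<^esub>)"
proof (cases "h = \<one>\<^bsub>G\<^esub>")
  case True
  have "(\<Oplus>\<^bsub>K\<^esub> g \<in> carrier G. \<chi> g h) = (\<Oplus>\<^bsub>K\<^esub> g \<in> carrier G. \<one>\<^bsub>K\<^esub>)"
    using True by (intro K.finsum_cong') auto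
  then show ?thesis using True finsum_one by simp
next
  case False
  then obtain y where y: "y \<in> carrier G" "\<chi> y h \<noteq> \<one>\<^bsub>K\<^esub>" using characters_separate_points h by blast
  let ?S = "\<Oplus>\<^bsub>K\<^esub> g \<in> carrier G. \<chi> g h"
  have S: "?S \<in> carrier K" using h by (intro K.finsum_closed) auto
  have "\<chi> y h \<otimes>\<^bsub>K\<^esub> ?S = (\<Oplus>\<^bsub>K\<^esub> g \<in> carrier G. \<chi> (y \<otimes>\<^bsub>G\<^esub> g) h)"
    using h y finite_G by (subst K.finsum_rdistr) (auto simp: chi_mult_left intro!: K.finsum_cong')
  also have "\<dots> = ?S" using h y by (intro K.finsum_translate[OF G.is_group, of _ "\<lambda>g. \<chi> g h"]) auto
  finally have "\<chi> y h \<otimes>\<^bsub>K\<^esub> ?S = \<one>\<^bsub>K\<^esub> \<otimes>\<^bsub>K\<^esub> ?S" using S by simp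
  then have "?S = \<zero>\<^bsub>K\<^esub>" using S h y K.m_rcancel[of ?S "\<chi> y h" "\<one>\<^bsub>K\<^esub>"] by auto
  then show ?thesis using False by simp
qed

end

section \<open>The twisted group algebra\<close>

locale twisted_setting = A: assoc_algebra K A + G: comm_group G
  for K :: "('k, 'l) ring_scheme" and A :: "('k, 'a, 'm) module_scheme"
    and G :: "('g, 'n) monoid_scheme" +
  fixes \<mu> :: "'g \<Rightarrow> 'g \<Rightarrow> 'k"
  assumes fin_G: "finite (carrier G)"
    and cocycle: "normalised_2_cocycle G K \<mu>"
begin

abbreviation B where "B \<equiv> twisted_group_algebra A G \<mu>"

lemma mu_closed [simp]: "\<lbrakk>g \<in> carrier G; h \<in> carrier G\<rbrakk> \<Longrightarrow> \<mu> g h \<in> carrier K"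
  and mu_one [simp]: "g \<in> carrier G \<Longrightarrow> \<mu> \<one>\<^bsub>G\<^esub> g = \<one>\<^bsub>K\<^esub>" "g \<in> carrier G \<Longrightarrow> \<mu> g \<one>\<^bsub>G\<^esub> = \<one>\<^bsub>K\<^esub>"
  and mu_cocycle: "\<lbrakk>g \<in> carrier G; h \<in> carrier G; l \<in> carrier G\<rbrakk> \<Longrightarrow>
    \<mu> g h \<otimes>\<^bsub>K\<^esub> \<mu> (g \<otimes>\<^bsub>G\<^esub> h) l = \<mu> g (h \<otimes>\<^bsub>G\<^esub> l) \<otimes>\<^bsub>K\<^esub> \<mu> h l"
  using cocycle by (auto simp: normalised_2_cocycle_def)

section \<open>Coordinates of the twisted group algebra\<close>

lemma tga_app_closed [simp]: "\<lbrakk>x \<in> carrier B; g \<in> carrier G\<rbrakk> \<Longrightarrow> x g \<in> carrier A"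
  by (auto simp: twisted_group_algebra_def)

lemma tga_eqI: "\<lbrakk>x \<in> carrier B; y \<in> carrier B; \<And>g. g \<in> carrier G \<Longrightarrow> x g = y g\<rbrakk> \<Longrightarrow> x = y"
  by (auto simp: twisted_group_algebra_def intro: PiE_ext)

lemma tga_app:
  assumes "l \<in> carrier G"
  shows "(x \<oplus>\<^bsub>B\<^esub> y) l = x l \<oplus>\<^bsub>A\<^esub> y l"
    and "\<zero>\<^bsub>B\<^esub> l = \<zero>\<^bsub>A\<^esub>"
    and "\<one>\<^bsub>B\<^esub> l = (if l = \<one>\<^bsub>G\<^esub> then \<one>\<^bsub>A\<^esub> else \<zero>\<^bsub>A\<^esub>)"
    and "(c \<odot>\<^bsub>B\<^esub> x) l = c \<odot>\<^bsub>A\<^esub> x l"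
  using assms by (auto simp: twisted_group_algebra_def)

text \<open>For given g and l the equation g h = l has exactly one solution h, so the inner sum of
  the definition has a single term.\<close>

lemma tga_mult_app:
  assumes x: "x \<in> carrier B" and y: "y \<in> carrier B" and l: "l \<in> carrier G"
  shows "(x \<otimes>\<^bsub>B\<^esub> y) l =
    (\<Oplus>\<^bsub>A\<^esub> g \<in> carrier G. \<mu> g (inv\<^bsub>G\<^esub> g \<otimes>\<^bsub>G\<^esub> l) \<odot>\<^bsub>A\<^esub> (x g \<otimes>\<^bsub>A\<^esub> y (inv\<^bsub>G\<^esub> g \<otimes>\<^bsub>G\<^esub> l)))"
proof -
  have "{h \<in> carrier G. g \<otimes>\<^bsub>G\<^esub> h = l} = {inv\<^bsub>G\<^esub> g \<otimes>\<^bsub>G\<^esub> l}" if "g \<in> carrier G" for g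
    using that l by (auto simp: G.inv_solve_left G.m_assoc[symmetric])
  then show ?thesis
    using x y l by (auto simp: twisted_group_algebra_def Pi_iff intro!: A.finsum_cong')
qed

lemma tga_closed [simp]:
  shows "\<lbrakk>x \<in> carrier B; y \<in> carrier B\<rbrakk> \<Longrightarrow> x \<oplus>\<^bsub>B\<^esub> y \<in> carrier B"
    and "\<lbrakk>x \<in> carrier B; y \<in> carrier B\<rbrakk> \<Longrightarrow> x \<otimes>\<^bsub>B\<^esub> y \<in> carrier B"
    and "\<one>\<^bsub>B\<^esub> \<in> carrier B" "\<zero>\<^bsub>B\<^esub> \<in> carrier B"
    and "\<lbrakk>c \<in> carrier K; x \<in> carrier B\<rbrakk> \<Longrightarrow> c \<odot>\<^bsub>B\<^esub> x \<in> carrier B"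
  by (auto simp: twisted_group_algebra_def Pi_iff intro!: A.M.finsum_closed)

text \<open>Both bracketings expand into double sums over the ways of writing l as a product of
  three degrees; the cocycle identity matches the coefficients term by term.\<close>

lemma tga_assoc:
  assumes x: "x \<in> carrier B" and y: "y \<in> carrier B" and z: "z \<in> carrier B"
  shows "(x \<otimes>\<^bsub>B\<^esub> y) \<otimes>\<^bsub>B\<^esub> z = x \<otimes>\<^bsub>B\<^esub> (y \<otimes>\<^bsub>B\<^esub> z)"
proof (rule tga_eqI)
  fix l assume l: "l \<in> carrier G"
  \<comment> \<open>A term of the left bracketing: g is the degree taken from x, and p the degree of
    the partial product of x and y.\<close>
  define H where "H g p = (\<mu> g (inv\<^bsub>G\<^esub> g \<otimes>\<^bsub>G\<^esub> p) \<otimes>\<^bsub>K\<^esub> \<mu> p (inv\<^bsub>G\<^esub> p \<otimes>\<^bsub>G\<^esub> l)) \<odot>\<^bsub>A\<^esub>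
    (x g \<otimes>\<^bsub>A\<^esub> y (inv\<^bsub>G\<^esub> g \<otimes>\<^bsub>G\<^esub> p) \<otimes>\<^bsub>A\<^esub> z (inv\<^bsub>G\<^esub> p \<otimes>\<^bsub>G\<^esub> l))" for g p
  have H: "H g p \<in> carrier A" if "g \<in> carrier G" "p \<in> carrier G" for g p
    using that x y z l by (auto simp: H_def)
  have "((x \<otimes>\<^bsub>B\<^esub> y) \<otimes>\<^bsub>B\<^esub> z) l = (\<Oplus>\<^bsub>A\<^esub> p \<in> carrier G. \<Oplus>\<^bsub>A\<^esub> g \<in> carrier G. H g p)"
    unfolding tga_mult_app[OF tga_closed(2)[OF x y] z l]
  proof (intro A.M.finsum_cong' refl)
    fix p assume p: "p \<in> carrier G"
    have "\<mu> p (inv\<^bsub>G\<^esub> p \<otimes>\<^bsub>G\<^esub> l) \<odot>\<^bsub>A\<^esub> ((x \<otimes>\<^bsub>B\<^esub> y) p \<otimes>\<^bsub>A\<^esub> z (inv\<^bsub>G\<^esub> p \<otimes>\<^bsub>G\<^esub> l)) =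
      (\<Oplus>\<^bsub>A\<^esub> g \<in> carrier G. \<mu> p (inv\<^bsub>G\<^esub> p \<otimes>\<^bsub>G\<^esub> l) \<odot>\<^bsub>A\<^esub>
        ((\<mu> g (inv\<^bsub>G\<^esub> g \<otimes>\<^bsub>G\<^esub> p) \<odot>\<^bsub>A\<^esub> (x g \<otimes>\<^bsub>A\<^esub> y (inv\<^bsub>G\<^esub> g \<otimes>\<^bsub>G\<^esub> p))) \<otimes>\<^bsub>A\<^esub> z (inv\<^bsub>G\<^esub> p \<otimes>\<^bsub>G\<^esub> l)))"
      using x y z l p fin_G
      by (simp add: tga_mult_app A.finsum_ldistr A.finsum_smult_ldistr Pi_iff)
    also have "\<dots> = (\<Oplus>\<^bsub>A\<^esub> g \<in> carrier G. H g p)"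
      using x y z l p
      by (intro A.M.finsum_cong' refl)
        (auto simp: H_def A.smult_mult_left A.smult_assoc1[symmetric] A.R.m_comm)
    finally show "\<mu> p (inv\<^bsub>G\<^esub> p \<otimes>\<^bsub>G\<^esub> l) \<odot>\<^bsub>A\<^esub> ((x \<otimes>\<^bsub>B\<^esub> y) p \<otimes>\<^bsub>A\<^esub> z (inv\<^bsub>G\<^esub> p \<otimes>\<^bsub>G\<^esub> l)) =
      (\<Oplus>\<^bsub>A\<^esub> g \<in> carrier G. H g p)" .
  qed (auto intro!: A.M.finsum_closed H)
  also have "\<dots> = (\<Oplus>\<^bsub>A\<^esub> g \<in> carrier G. \<Oplus>\<^bsub>A\<^esub> p \<in> carrier G. H g p)"
    using fin_G H by (intro A.M.finsum_swap) auto
  \<comment> \<open>Substituting p = g h makes h the degree taken from y, as in the right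
    bracketing.\<close>
  also have "\<dots> = (\<Oplus>\<^bsub>A\<^esub> g \<in> carrier G. \<Oplus>\<^bsub>A\<^esub> h \<in> carrier G. H g (g \<otimes>\<^bsub>G\<^esub> h))"
    using H by (intro A.M.finsum_cong' refl A.M.finsum_translate[symmetric] G.is_group)
      (auto intro!: A.M.finsum_closed)
  also have "\<dots> = (x \<otimes>\<^bsub>B\<^esub> (y \<otimes>\<^bsub>B\<^esub> z)) l"
    unfolding tga_mult_app[OF x tga_closed(2)[OF y z] l]
  proof (intro A.M.finsum_cong' refl)
    fix g assume g: "g \<in> carrier G"
    define m where "m = inv\<^bsub>G\<^esub> g \<otimes>\<^bsub>G\<^esub> l"
    have m: "m \<in> carrier G" using g l by (simp add: m_def)
    have "\<mu> g m \<odot>\<^bsub>A\<^esub> (x g \<otimes>\<^bsub>A\<^esub> (y \<otimes>\<^bsub>B\<^esub> z) m) =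
      (\<Oplus>\<^bsub>A\<^esub> h \<in> carrier G. \<mu> g m \<odot>\<^bsub>A\<^esub>
        (x g \<otimes>\<^bsub>A\<^esub> (\<mu> h (inv\<^bsub>G\<^esub> h \<otimes>\<^bsub>G\<^esub> m) \<odot>\<^bsub>A\<^esub> (y h \<otimes>\<^bsub>A\<^esub> z (inv\<^bsub>G\<^esub> h \<otimes>\<^bsub>G\<^esub> m)))))"
      using x y z g m fin_G
      by (simp add: tga_mult_app A.finsum_rdistr A.finsum_smult_ldistr Pi_iff)
    also have "\<dots> = (\<Oplus>\<^bsub>A\<^esub> h \<in> carrier G. H g (g \<otimes>\<^bsub>G\<^esub> h))"
    proof (intro A.M.finsum_cong' refl)
      fix h assume h: "h \<in> carrier G"
      \<comment> \<open>The degree left for z: g h n = l and h n = m, so the cocycle identity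
        applies to g, h, n.\<close>
      define n where "n = inv\<^bsub>G\<^esub> h \<otimes>\<^bsub>G\<^esub> m"
      have n: "n \<in> carrier G" using h m by (simp add: n_def)
      have m_eq: "h \<otimes>\<^bsub>G\<^esub> n = m" using h m by (simp add: n_def G.m_assoc[symmetric])
      have "inv\<^bsub>G\<^esub> g \<otimes>\<^bsub>G\<^esub> (g \<otimes>\<^bsub>G\<^esub> h) = h" using g h by (simp add: G.m_assoc[symmetric])
      moreover have "inv\<^bsub>G\<^esub> (g \<otimes>\<^bsub>G\<^esub> h) \<otimes>\<^bsub>G\<^esub> l = n"
        using g h l by (simp add: n_def m_def G.inv_mult_group G.m_assoc)
      ultimately show "\<mu> g m \<odot>\<^bsub>A\<^esub> (x g \<otimes>\<^bsub>A\<^esub> (\<mu> h (inv\<^bsub>G\<^esub> h \<otimes>\<^bsub>G\<^esub> m) \<odot>\<^bsub>A\<^esub>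
          (y h \<otimes>\<^bsub>A\<^esub> z (inv\<^bsub>G\<^esub> h \<otimes>\<^bsub>G\<^esub> m)))) = H g (g \<otimes>\<^bsub>G\<^esub> h)"
        using x y z g h n m mu_cocycle[OF g h n, unfolded m_eq]
        by (simp add: H_def flip: n_def) (simp add: A.smult_mult_right A.smult_assoc1 A.m_assoc)
    qed (use H g in auto)
    finally show "(\<Oplus>\<^bsub>A\<^esub> h \<in> carrier G. H g (g \<otimes>\<^bsub>G\<^esub> h)) =
        \<mu> g (inv\<^bsub>G\<^esub> g \<otimes>\<^bsub>G\<^esub> l) \<odot>\<^bsub>A\<^esub> (x g \<otimes>\<^bsub>A\<^esub> (y \<otimes>\<^bsub>B\<^esub> z) (inv\<^bsub>G\<^esub> g \<otimes>\<^bsub>G\<^esub> l))"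
      by (simp add: m_def)
  qed (use x y z l in auto)
  finally show "((x \<otimes>\<^bsub>B\<^esub> y) \<otimes>\<^bsub>B\<^esub> z) l = (x \<otimes>\<^bsub>B\<^esub> (y \<otimes>\<^bsub>B\<^esub> z)) l" .
qed (use x y z in auto)

text \<open>The unit is supported at the identity of G, so one term of the convolution survives, and
  normalisation makes its coefficient 1.\<close>

lemma tga_one_mult:
  assumes x: "x \<in> carrier B"
  shows "\<one>\<^bsub>B\<^esub> \<otimes>\<^bsub>B\<^esub> x = x" "x \<otimes>\<^bsub>B\<^esub> \<one>\<^bsub>B\<^esub> = x"
proof -
  show "\<one>\<^bsub>B\<^esub> \<otimes>\<^bsub>B\<^esub> x = x"
  proof (rule tga_eqI)
    fix l assume l: "l \<in> carrier G"
    have "(\<one>\<^bsub>B\<^esub> \<otimes>\<^bsub>B\<^esub> x) l = (\<Oplus>\<^bsub>A\<^esub> g \<in> carrier G. if \<one>\<^bsub>G\<^esub> = g then x l else \<zero>\<^bsub>A\<^esub>)"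
      unfolding tga_mult_app[OF tga_closed(3) x l] using x l
      by (intro A.M.finsum_cong') (auto simp: tga_app)
    then show "(\<one>\<^bsub>B\<^esub> \<otimes>\<^bsub>B\<^esub> x) l = x l"
      using x l fin_G A.M.finsum_singleton[of "\<one>\<^bsub>G\<^esub>" "carrier G" "\<lambda>_. x l"] by simp
  qed (use x in auto)
  show "x \<otimes>\<^bsub>B\<^esub> \<one>\<^bsub>B\<^esub> = x"
  proof (rule tga_eqI)
    fix l assume l: "l \<in> carrier G"
    have "inv\<^bsub>G\<^esub> g \<otimes>\<^bsub>G\<^esub> l = \<one>\<^bsub>G\<^esub> \<longleftrightarrow> l = g" if "g \<in> carrier G" for g
      using that l by (metis G.inv_closed G.inv_equality G.inv_inv G.l_inv)
    then have "(x \<otimes>\<^bsub>B\<^esub> \<one>\<^bsub>B\<^esub>) l = (\<Oplus>\<^bsub>A\<^esub> g \<in> carrier G. if l = g then x l else \<zero>\<^bsub>A\<^esub>)"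
      unfolding tga_mult_app[OF x tga_closed(3) l] using x l
      by (intro A.M.finsum_cong') (auto simp: tga_app)
    then show "(x \<otimes>\<^bsub>B\<^esub> \<one>\<^bsub>B\<^esub>) l = x l"
      using x l fin_G A.M.finsum_singleton[of l "carrier G" "\<lambda>_. x l"] by simp
  qed (use x in auto)
qed

lemma tga_distr:
  assumes B: "x \<in> carrier B" "y \<in> carrier B" "z \<in> carrier B"
  shows "(x \<oplus>\<^bsub>B\<^esub> y) \<otimes>\<^bsub>B\<^esub> z = x \<otimes>\<^bsub>B\<^esub> z \<oplus>\<^bsub>B\<^esub> y \<otimes>\<^bsub>B\<^esub> z"
    and "z \<otimes>\<^bsub>B\<^esub> (x \<oplus>\<^bsub>B\<^esub> y) = z \<otimes>\<^bsub>B\<^esub> x \<oplus>\<^bsub>B\<^esub> z \<otimes>\<^bsub>B\<^esub> y"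
proof (rule_tac [!] tga_eqI)
  fix l assume l: "l \<in> carrier G"
  let ?t = "\<lambda>u v g. \<mu> g (inv\<^bsub>G\<^esub> g \<otimes>\<^bsub>G\<^esub> l) \<odot>\<^bsub>A\<^esub> (u g \<otimes>\<^bsub>A\<^esub> v (inv\<^bsub>G\<^esub> g \<otimes>\<^bsub>G\<^esub> l))"
  have t: "?t u v \<in> carrier G \<rightarrow> carrier A" if "u \<in> carrier B" "v \<in> carrier B" for u v
    using that l by auto
  have "(\<Oplus>\<^bsub>A\<^esub> g \<in> carrier G. ?t (x \<oplus>\<^bsub>B\<^esub> y) z g) = (\<Oplus>\<^bsub>A\<^esub> g \<in> carrier G. ?t x z g \<oplus>\<^bsub>A\<^esub> ?t y z g)"
    using B l by (intro A.M.finsum_cong') (auto simp: tga_app A.l_distr A.smult_r_distr)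
  then show "((x \<oplus>\<^bsub>B\<^esub> y) \<otimes>\<^bsub>B\<^esub> z) l = (x \<otimes>\<^bsub>B\<^esub> z \<oplus>\<^bsub>B\<^esub> y \<otimes>\<^bsub>B\<^esub> z) l"
    using B l t by (simp add: tga_app tga_mult_app A.M.finsum_addf)
  have "(\<Oplus>\<^bsub>A\<^esub> g \<in> carrier G. ?t z (x \<oplus>\<^bsub>B\<^esub> y) g) = (\<Oplus>\<^bsub>A\<^esub> g \<in> carrier G. ?t z x g \<oplus>\<^bsub>A\<^esub> ?t z y g)"
    using B l by (intro A.M.finsum_cong') (auto simp: tga_app A.r_distr A.smult_r_distr)
  then show "(z \<otimes>\<^bsub>B\<^esub> (x \<oplus>\<^bsub>B\<^esub> y)) l = (z \<otimes>\<^bsub>B\<^esub> x \<oplus>\<^bsub>B\<^esub> z \<otimes>\<^bsub>B\<^esub> y) l"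
    using B l t by (simp add: tga_app tga_mult_app A.M.finsum_addf)
qed (use B in auto)

lemma tga_smult_mult:
  assumes B: "c \<in> carrier K" "x \<in> carrier B" "y \<in> carrier B"
  shows "(c \<odot>\<^bsub>B\<^esub> x) \<otimes>\<^bsub>B\<^esub> y = c \<odot>\<^bsub>B\<^esub> (x \<otimes>\<^bsub>B\<^esub> y)"
    and "x \<otimes>\<^bsub>B\<^esub> (c \<odot>\<^bsub>B\<^esub> y) = c \<odot>\<^bsub>B\<^esub> (x \<otimes>\<^bsub>B\<^esub> y)"
proof (rule_tac [!] tga_eqI)
  fix l assume l: "l \<in> carrier G"
  let ?t = "\<lambda>u v g. \<mu> g (inv\<^bsub>G\<^esub> g \<otimes>\<^bsub>G\<^esub> l) \<odot>\<^bsub>A\<^esub> (u g \<otimes>\<^bsub>A\<^esub> v (inv\<^bsub>G\<^esub> g \<otimes>\<^bsub>G\<^esub> l))"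
  have c: "(\<Oplus>\<^bsub>A\<^esub> g \<in> carrier G. c \<odot>\<^bsub>A\<^esub> ?t x y g) = c \<odot>\<^bsub>A\<^esub> (\<Oplus>\<^bsub>A\<^esub> g \<in> carrier G. ?t x y g)"
    using B l fin_G by (intro A.finsum_smult_ldistr[symmetric]) auto
  have "(\<Oplus>\<^bsub>A\<^esub> g \<in> carrier G. ?t (c \<odot>\<^bsub>B\<^esub> x) y g) = (\<Oplus>\<^bsub>A\<^esub> g \<in> carrier G. c \<odot>\<^bsub>A\<^esub> ?t x y g)"
    using B l by (intro A.M.finsum_cong')
      (auto simp: tga_app A.smult_mult_left A.smult_assoc1[symmetric] A.R.m_comm)
  then show "((c \<odot>\<^bsub>B\<^esub> x) \<otimes>\<^bsub>B\<^esub> y) l = (c \<odot>\<^bsub>B\<^esub> (x \<otimes>\<^bsub>B\<^esub> y)) l"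
    using B l c by (simp add: tga_app tga_mult_app)
  have "(\<Oplus>\<^bsub>A\<^esub> g \<in> carrier G. ?t x (c \<odot>\<^bsub>B\<^esub> y) g) = (\<Oplus>\<^bsub>A\<^esub> g \<in> carrier G. c \<odot>\<^bsub>A\<^esub> ?t x y g)"
    using B l by (intro A.M.finsum_cong')
      (auto simp: tga_app A.smult_mult_right A.smult_assoc1[symmetric] A.R.m_comm)
  then show "(x \<otimes>\<^bsub>B\<^esub> (c \<odot>\<^bsub>B\<^esub> y)) l = (c \<odot>\<^bsub>B\<^esub> (x \<otimes>\<^bsub>B\<^esub> y)) l"
    using B l c by (simp add: tga_app tga_mult_app)
qed (use B in auto)

lemma assoc_algebra_tga: "assoc_algebra K B"
proof -
  have ag: "abelian_group B"
  proof (rule abelian_groupI)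
    fix x assume x: "x \<in> carrier B"
    have "(\<lambda>l \<in> carrier G. \<ominus>\<^bsub>A\<^esub> x l) \<in> carrier B"
      using x by (auto simp: twisted_group_algebra_def)
    moreover from this have "(\<lambda>l \<in> carrier G. \<ominus>\<^bsub>A\<^esub> x l) \<oplus>\<^bsub>B\<^esub> x = \<zero>\<^bsub>B\<^esub>"
      using x by (intro tga_eqI) (auto simp: tga_app A.M.l_neg)
    ultimately show "\<exists>y \<in> carrier B. y \<oplus>\<^bsub>B\<^esub> x = \<zero>\<^bsub>B\<^esub>" by blast
  qed (auto intro!: tga_eqI simp: tga_app A.M.a_ac)
  moreover have "monoid B"
    by (rule monoidI) (auto simp: tga_assoc tga_one_mult)
  ultimately have "ring B" by (intro ringI tga_distr)
  moreover have "module K B"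
    by (intro module.intro module_axioms.intro ag A.R.is_cring)
      (auto intro!: tga_eqI simp: tga_app A.smult_l_distr A.smult_r_distr A.smult_assoc1)
  ultimately show ?thesis
    by (intro assoc_algebra.intro assoc_algebra_axioms.intro tga_smult_mult)
qed

end

section \<open>The grading induced by the action\<close>

locale twist_data = self_dual_group K G \<chi> + twisted_setting K A G \<mu>
  for K :: "('k, 'l) ring_scheme" and A :: "('k, 'a, 'm) module_scheme"
    and G :: "('g, 'n) monoid_scheme" and \<chi> \<mu> :: "'g \<Rightarrow> 'g \<Rightarrow> 'k" +
  fixes \<phi> :: "'g \<Rightarrow> 'a \<Rightarrow> 'a"
  assumes action: "acts_by_alg_auts K A G \<phi>"
begin

section \<open>The action by algebra automorphisms\<close>

lemma phi_hom: "h \<in> carrier G \<Longrightarrow> \<phi> h \<in> ring_hom A A"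
  and phi_smult: "\<lbrakk>h \<in> carrier G; c \<in> carrier K; a \<in> carrier A\<rbrakk> \<Longrightarrow> \<phi> h (c \<odot>\<^bsub>A\<^esub> a) = c \<odot>\<^bsub>A\<^esub> \<phi> h a"
  using action by (auto simp: acts_by_alg_auts_def alg_iso_def ring_iso_def)

lemma phi_closed [simp]: "\<lbrakk>h \<in> carrier G; a \<in> carrier A\<rbrakk> \<Longrightarrow> \<phi> h a \<in> carrier A"
  and phi_one [simp]: "h \<in> carrier G \<Longrightarrow> \<phi> h \<one>\<^bsub>A\<^esub> = \<one>\<^bsub>A\<^esub>"
  and phi_add: "\<lbrakk>h \<in> carrier G; a \<in> carrier A; b \<in> carrier A\<rbrakk> \<Longrightarrow> \<phi> h (a \<oplus>\<^bsub>A\<^esub> b) = \<phi> h a \<oplus>\<^bsub>A\<^esub> \<phi> h b"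
  and phi_mult: "\<lbrakk>h \<in> carrier G; a \<in> carrier A; b \<in> carrier A\<rbrakk> \<Longrightarrow> \<phi> h (a \<otimes>\<^bsub>A\<^esub> b) = \<phi> h a \<otimes>\<^bsub>A\<^esub> \<phi> h b"
  using phi_hom[of h] by (auto dest: ring_hom_closed ring_hom_one ring_hom_add ring_hom_mult)

lemma phi_comp: "\<lbrakk>g \<in> carrier G; h \<in> carrier G; a \<in> carrier A\<rbrakk> \<Longrightarrow> \<phi> g (\<phi> h a) = \<phi> (g \<otimes>\<^bsub>G\<^esub> h) a"
  and phi_one_left [simp]: "a \<in> carrier A \<Longrightarrow> \<phi> \<one>\<^bsub>G\<^esub> a = a"
proof -
  interpret group_action G "carrier A" \<phi> using action by (simp add: acts_by_alg_auts_def)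
  show "\<lbrakk>g \<in> carrier G; h \<in> carrier G; a \<in> carrier A\<rbrakk> \<Longrightarrow> \<phi> g (\<phi> h a) = \<phi> (g \<otimes>\<^bsub>G\<^esub> h) a"
    by (simp add: composition_rule)
  show "a \<in> carrier A \<Longrightarrow> \<phi> \<one>\<^bsub>G\<^esub> a = a"
    using fun_cong[OF id_eq_one, of a] by simp
qed

lemma phi_finsum:
  assumes "h \<in> carrier G" "\<And>i. i \<in> I \<Longrightarrow> f i \<in> carrier A"
  shows "\<phi> h (\<Oplus>\<^bsub>A\<^esub> i \<in> I. f i) = (\<Oplus>\<^bsub>A\<^esub> i \<in> I. \<phi> h (f i))"
proof -
  interpret h: ring_hom_ring A A "\<phi> h"
    using A.ring_axioms phi_hom[OF assms(1)] by (intro ring_hom_ringI2) auto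
  show ?thesis using h.hom_finsum[of f I] assms by (simp add: comp_def Pi_iff)
qed

section \<open>Closure properties of the homogeneous parts\<close>

abbreviation hp where "hp \<equiv> homogeneous_part A G \<phi> \<chi>"

lemma hp_closed: "a \<in> hp g \<Longrightarrow> a \<in> carrier A"
  and hp_phi: "\<lbrakk>a \<in> hp g; h \<in> carrier G\<rbrakk> \<Longrightarrow> \<phi> h a = \<chi> (inv\<^bsub>G\<^esub> g) h \<odot>\<^bsub>A\<^esub> a"
  by (auto simp: homogeneous_part_def)

lemma hp_zero: "g \<in> carrier G \<Longrightarrow> \<zero>\<^bsub>A\<^esub> \<in> hp g"
proof -
  assume g: "g \<in> carrier G"
  have "\<phi> h \<zero>\<^bsub>A\<^esub> = \<zero>\<^bsub>A\<^esub>" if "h \<in> carrier G" for h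
    using phi_smult[OF that K.zero_closed A.M.zero_closed] that by simp
  then show ?thesis using g by (auto simp: homogeneous_part_def)
qed

lemma hp_one: "\<one>\<^bsub>A\<^esub> \<in> hp \<one>\<^bsub>G\<^esub>"
  by (auto simp: homogeneous_part_def)

lemma hp_add: "\<lbrakk>g \<in> carrier G; a \<in> hp g; b \<in> hp g\<rbrakk> \<Longrightarrow> a \<oplus>\<^bsub>A\<^esub> b \<in> hp g"
  by (auto simp: homogeneous_part_def phi_add A.smult_r_distr)

lemma hp_smult: "\<lbrakk>g \<in> carrier G; c \<in> carrier K; a \<in> hp g\<rbrakk> \<Longrightarrow> c \<odot>\<^bsub>A\<^esub> a \<in> hp g"
  by (auto simp: homogeneous_part_def phi_smult A.smult_assoc1[symmetric] K.m_comm)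

text \<open>Automorphisms are multiplicative, so the weights of a and b multiply, and \<chi> turns
  the product of the inverse degrees into this product of weights.\<close>

lemma hp_mult:
  assumes "g \<in> carrier G" "h \<in> carrier G" "a \<in> hp g" "b \<in> hp h"
  shows "a \<otimes>\<^bsub>A\<^esub> b \<in> hp (g \<otimes>\<^bsub>G\<^esub> h)"
  using assms
  by (auto simp: homogeneous_part_def phi_mult G.inv_mult chi_mult_left
      A.smult_mult_left A.smult_mult_right A.smult_assoc1[symmetric] K.m_comm)

lemma hp_finsum:
  assumes "finite I" "g \<in> carrier G" "\<And>i. i \<in> I \<Longrightarrow> f i \<in> hp g"
  shows "(\<Oplus>\<^bsub>A\<^esub> i \<in> I. f i) \<in> hp g"
  using assms(1,3)
proof (induction I rule: finite_induct)
  case empty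
  then show ?case using hp_zero assms(2) by simp
next
  case (insert i I)
  then show ?case using assms(2) hp_closed by (subst A.M.finsum_insert) (auto intro!: hp_add)
qed

text \<open>The projection to a weight \<psi> averages the inverse of \<psi>(h) times a^h. Degree g
  has weight \<open>\<chi> (inv g)\<close>, hence the factor \<open>\<chi> g h\<close>.\<close>

definition proj :: "'g \<Rightarrow> 'a \<Rightarrow> 'a" where
  "proj g a = inv\<^bsub>K\<^esub> order_K \<odot>\<^bsub>A\<^esub> (\<Oplus>\<^bsub>A\<^esub> h \<in> carrier G. \<chi> g h \<odot>\<^bsub>A\<^esub> \<phi> h a)"

lemma inv_order_K [simp]:
  "inv\<^bsub>K\<^esub> order_K \<in> carrier K" "inv\<^bsub>K\<^esub> order_K \<otimes>\<^bsub>K\<^esub> order_K = \<one>\<^bsub>K\<^esub>"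
  using order_K_nonzero by (simp_all add: K.field_Units)

lemma proj_in_hp:
  assumes g: "g \<in> carrier G" and a: "a \<in> carrier A"
  shows "proj g a \<in> hp g"
proof -
  let ?S = "\<Oplus>\<^bsub>A\<^esub> h \<in> carrier G. \<chi> g h \<odot>\<^bsub>A\<^esub> \<phi> h a"
  have S: "?S \<in> carrier A" using g a by (intro A.M.finsum_closed) auto
  have "\<phi> k ?S = \<chi> (inv\<^bsub>G\<^esub> g) k \<odot>\<^bsub>A\<^esub> ?S" if k: "k \<in> carrier G" for k
  proof -
    have "\<phi> k ?S = (\<Oplus>\<^bsub>A\<^esub> h \<in> carrier G. \<chi> g h \<odot>\<^bsub>A\<^esub> \<phi> (k \<otimes>\<^bsub>G\<^esub> h) a)"
      using g a k by (subst phi_finsum) (auto simp: phi_smult phi_comp intro!: A.M.finsum_cong')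
    \<comment> \<open>Inserting the factor 1 as the product of \<open>\<chi> (inv g) k\<close> and
      \<open>\<chi> g k\<close> makes the summand, up to a constant, a function of k h, ready for
      translation.\<close>
    also have "\<dots> = (\<Oplus>\<^bsub>A\<^esub> h \<in> carrier G.
        \<chi> (inv\<^bsub>G\<^esub> g) k \<odot>\<^bsub>A\<^esub> (\<chi> g (k \<otimes>\<^bsub>G\<^esub> h) \<odot>\<^bsub>A\<^esub> \<phi> (k \<otimes>\<^bsub>G\<^esub> h) a))"
      using g a k
      by (intro A.M.finsum_cong')
        (auto simp: chi_mult_right A.smult_assoc1[symmetric] K.m_assoc[symmetric])
    also have "\<dots> = (\<Oplus>\<^bsub>A\<^esub> h \<in> carrier G. \<chi> (inv\<^bsub>G\<^esub> g) k \<odot>\<^bsub>A\<^esub> (\<chi> g h \<odot>\<^bsub>A\<^esub> \<phi> h a))"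
      using g a k
      by (intro A.M.finsum_translate[OF G.is_group, of _
            "\<lambda>h. \<chi> (inv\<^bsub>G\<^esub> g) k \<odot>\<^bsub>A\<^esub> (\<chi> g h \<odot>\<^bsub>A\<^esub> \<phi> h a)"]) auto
    also have "\<dots> = \<chi> (inv\<^bsub>G\<^esub> g) k \<odot>\<^bsub>A\<^esub> ?S"
      using g a k fin_G by (intro A.finsum_smult_ldistr[symmetric]) auto
    finally show ?thesis .
  qed
  then have "?S \<in> hp g" using S by (simp add: homogeneous_part_def)
  then show ?thesis unfolding proj_def using g by (intro hp_smult) auto
qed

text \<open>After exchanging the sums, orthogonality over the characters kills every a^h except the
  one for the identity.\<close>

lemma sum_proj:
  assumes a: "a \<in> carrier A"
  shows "(\<Oplus>\<^bsub>A\<^esub> g \<in> carrier G. proj g a) = a"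
proof -
  have "(\<Oplus>\<^bsub>A\<^esub> g \<in> carrier G. proj g a) =
    inv\<^bsub>K\<^esub> order_K \<odot>\<^bsub>A\<^esub> (\<Oplus>\<^bsub>A\<^esub> g \<in> carrier G. \<Oplus>\<^bsub>A\<^esub> h \<in> carrier G. \<chi> g h \<odot>\<^bsub>A\<^esub> \<phi> h a)"
    unfolding proj_def using a fin_G
    by (intro A.finsum_smult_ldistr[symmetric]) (auto intro!: A.M.finsum_closed)
  also have "(\<Oplus>\<^bsub>A\<^esub> g \<in> carrier G. \<Oplus>\<^bsub>A\<^esub> h \<in> carrier G. \<chi> g h \<odot>\<^bsub>A\<^esub> \<phi> h a) =
    (\<Oplus>\<^bsub>A\<^esub> h \<in> carrier G. \<Oplus>\<^bsub>A\<^esub> g \<in> carrier G. \<chi> g h \<odot>\<^bsub>A\<^esub> \<phi> h a)"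
    using a fin_G by (intro A.M.finsum_swap) auto
  also have "\<dots> = (\<Oplus>\<^bsub>A\<^esub> h \<in> carrier G. if \<one>\<^bsub>G\<^esub> = h then order_K \<odot>\<^bsub>A\<^esub> a else \<zero>\<^bsub>A\<^esub>)"
    using a by (intro A.M.finsum_cong') (auto simp: A.finsum_smult_rdistr fin_G sum_chi_over_characters)
  also have "\<dots> = order_K \<odot>\<^bsub>A\<^esub> a"
    using a fin_G by (intro A.M.finsum_singleton) auto
  finally show ?thesis using a by (simp add: A.smult_assoc1[symmetric])
qed

text \<open>On degree g the average defining \<open>proj k\<close> becomes the average of the
  character of k g^{-1}, which orthogonality over the group makes 1 for g = k and 0
  otherwise.\<close>

lemma proj_sum:
  assumes c: "c \<in> (\<Pi>\<^sub>E g \<in> carrier G. hp g)" and k: "k \<in> carrier G"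
  shows "proj k (\<Oplus>\<^bsub>A\<^esub> g \<in> carrier G. c g) = c k"
proof -
  have cg: "c g \<in> hp g" "c g \<in> carrier A" if "g \<in> carrier G" for g
    using c that hp_closed[of "c g" g] by auto
  have "(\<Oplus>\<^bsub>A\<^esub> h \<in> carrier G. \<chi> k h \<odot>\<^bsub>A\<^esub> \<phi> h (\<Oplus>\<^bsub>A\<^esub> g \<in> carrier G. c g)) =
    (\<Oplus>\<^bsub>A\<^esub> h \<in> carrier G. \<Oplus>\<^bsub>A\<^esub> g \<in> carrier G. \<chi> (k \<otimes>\<^bsub>G\<^esub> inv\<^bsub>G\<^esub> g) h \<odot>\<^bsub>A\<^esub> c g)"
  proof (intro A.M.finsum_cong' refl)
    fix h assume h: "h \<in> carrier G"
    have "\<chi> k h \<odot>\<^bsub>A\<^esub> \<phi> h (\<Oplus>\<^bsub>A\<^esub> g \<in> carrier G. c g) =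
      (\<Oplus>\<^bsub>A\<^esub> g \<in> carrier G. \<chi> k h \<odot>\<^bsub>A\<^esub> \<phi> h (c g))"
      using h k cg fin_G by (simp add: phi_finsum A.finsum_smult_ldistr Pi_iff)
    also have "\<dots> = (\<Oplus>\<^bsub>A\<^esub> g \<in> carrier G. \<chi> (k \<otimes>\<^bsub>G\<^esub> inv\<^bsub>G\<^esub> g) h \<odot>\<^bsub>A\<^esub> c g)"
      using h k cg
      by (intro A.M.finsum_cong') (auto simp: hp_phi[OF cg(1)] chi_mult_left A.smult_assoc1)
    finally show "\<chi> k h \<odot>\<^bsub>A\<^esub> \<phi> h (\<Oplus>\<^bsub>A\<^esub> g \<in> carrier G. c g) =
      (\<Oplus>\<^bsub>A\<^esub> g \<in> carrier G. \<chi> (k \<otimes>\<^bsub>G\<^esub> inv\<^bsub>G\<^esub> g) h \<odot>\<^bsub>A\<^esub> c g)" .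
  qed (use k cg in \<open>auto intro!: A.M.finsum_closed\<close>)
  also have "\<dots> = (\<Oplus>\<^bsub>A\<^esub> g \<in> carrier G. \<Oplus>\<^bsub>A\<^esub> h \<in> carrier G. \<chi> (k \<otimes>\<^bsub>G\<^esub> inv\<^bsub>G\<^esub> g) h \<odot>\<^bsub>A\<^esub> c g)"
    using k cg fin_G by (intro A.M.finsum_swap) auto
  also have "\<dots> = (\<Oplus>\<^bsub>A\<^esub> g \<in> carrier G. if k = g then order_K \<odot>\<^bsub>A\<^esub> c g else \<zero>\<^bsub>A\<^esub>)"
  proof (intro A.M.finsum_cong' refl)
    fix g assume g: "g \<in> carrier G"
    have "k \<otimes>\<^bsub>G\<^esub> inv\<^bsub>G\<^esub> g = \<one>\<^bsub>G\<^esub> \<longleftrightarrow> k = g"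
      using g k by (metis G.inv_closed G.inv_equality G.inv_inv G.r_inv)
    then show "(\<Oplus>\<^bsub>A\<^esub> h \<in> carrier G. \<chi> (k \<otimes>\<^bsub>G\<^esub> inv\<^bsub>G\<^esub> g) h \<odot>\<^bsub>A\<^esub> c g) =
        (if k = g then order_K \<odot>\<^bsub>A\<^esub> c g else \<zero>\<^bsub>A\<^esub>)"
      using g k cg by (auto simp: A.finsum_smult_rdistr fin_G sum_chi_over_group)
  qed (use cg in auto)
  also have "\<dots> = order_K \<odot>\<^bsub>A\<^esub> c k"
    using k cg fin_G by (intro A.M.finsum_singleton) auto
  finally show ?thesis using k cg by (simp add: proj_def A.smult_assoc1[symmetric])
qed

text \<open>Two decompositions with the same sum have the same projections, so they agree on G, and
  by extensionality everywhere. This gives the \<open>THE\<close> its value.\<close>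

lemma homogeneous_components_finsum:
  assumes c: "c \<in> (\<Pi>\<^sub>E g \<in> carrier G. hp g)"
  shows "homogeneous_components A G \<phi> \<chi> (\<Oplus>\<^bsub>A\<^esub> g \<in> carrier G. c g) = c"
  unfolding homogeneous_components_def
proof (rule the_equality)
  fix d assume d: "d \<in> (\<Pi>\<^sub>E g \<in> carrier G. hp g) \<and>
    (\<Oplus>\<^bsub>A\<^esub> g \<in> carrier G. d g) = (\<Oplus>\<^bsub>A\<^esub> g \<in> carrier G. c g)"
  then have "d g = c g" if "g \<in> carrier G" for g
    using proj_sum[OF c that] proj_sum[of d g] that by simp
  then show "d = c" using c d by (blast intro: PiE_ext)
qed (use c in simp)

section \<open>The isomorphism\<close>

abbreviation inv_alg where
  "inv_alg \<equiv> invariant_subring G (twisted_action A G \<phi> \<chi>) B"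

lemma hp_iff_twisted_invariant:
  assumes "g \<in> carrier G" "a \<in> carrier A"
  shows "a \<in> hp g \<longleftrightarrow> (\<forall>h \<in> carrier G. \<chi> g h \<odot>\<^bsub>A\<^esub> \<phi> h a = a)"
proof -
  have "\<phi> h a = \<chi> (inv\<^bsub>G\<^esub> g) h \<odot>\<^bsub>A\<^esub> a \<longleftrightarrow> \<chi> g h \<odot>\<^bsub>A\<^esub> \<phi> h a = a" if h: "h \<in> carrier G" for h
  proof
    assume "\<phi> h a = \<chi> (inv\<^bsub>G\<^esub> g) h \<odot>\<^bsub>A\<^esub> a"
    then show "\<chi> g h \<odot>\<^bsub>A\<^esub> \<phi> h a = a" using assms h by (simp add: A.smult_assoc1[symmetric])
  next
    assume "\<chi> g h \<odot>\<^bsub>A\<^esub> \<phi> h a = a"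
    then have "\<chi> (inv\<^bsub>G\<^esub> g) h \<odot>\<^bsub>A\<^esub> a = \<chi> (inv\<^bsub>G\<^esub> g) h \<odot>\<^bsub>A\<^esub> (\<chi> g h \<odot>\<^bsub>A\<^esub> \<phi> h a)" by simp
    also have "\<dots> = \<phi> h a" using assms h by (simp add: A.smult_assoc1[symmetric])
    finally show "\<phi> h a = \<chi> (inv\<^bsub>G\<^esub> g) h \<odot>\<^bsub>A\<^esub> a" by simp
  qed
  then show ?thesis using assms by (auto simp: homogeneous_part_def)
qed

lemma carrier_inv_alg: "carrier inv_alg = (\<Pi>\<^sub>E g \<in> carrier G. hp g)"
proof (intro Set.set_eqI iffI)
  fix x assume x: "x \<in> carrier inv_alg"
  then have xB: "x \<in> carrier B" by (simp add: invariant_subring_def)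
  have "x g \<in> hp g" if g: "g \<in> carrier G" for g
  proof -
    have "\<chi> g h \<odot>\<^bsub>A\<^esub> \<phi> h (x g) = x g" if "h \<in> carrier G" for h
    proof -
      have "twisted_action A G \<phi> \<chi> h x g = x g"
        using x that by (simp add: invariant_subring_def)
      then show ?thesis using g by (simp add: twisted_action_def)
    qed
    then show ?thesis using g xB by (simp add: hp_iff_twisted_invariant)
  qed
  then show "x \<in> (\<Pi>\<^sub>E g \<in> carrier G. hp g)"
    using xB by (auto simp: twisted_group_algebra_def)
next
  fix x assume x: "x \<in> (\<Pi>\<^sub>E g \<in> carrier G. hp g)"
  then have "x g \<in> carrier A" if "g \<in> carrier G" for g
    using that hp_closed[of "x g" g] by auto
  with x have xB: "x \<in> carrier B" by (auto simp: twisted_group_algebra_def)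
  have "twisted_action A G \<phi> \<chi> h x = x" if h: "h \<in> carrier G" for h
  proof
    fix g
    show "twisted_action A G \<phi> \<chi> h x g = x g"
    proof (cases "g \<in> carrier G")
      case True
      then have "x g \<in> hp g" using x by auto
      then show ?thesis
        using True h hp_iff_twisted_invariant[of g "x g"] hp_closed[of "x g" g]
        by (simp add: twisted_action_def)
    next
      \<comment> \<open>Outside the carrier both sides are \<open>undefined\<close>, by
        extensionality.\<close>
      case False
      then show ?thesis using x by (auto simp: twisted_action_def)
    qed
  qed
  then show "x \<in> carrier inv_alg" using xB by (simp add: invariant_subring_def)
qed

text \<open>Closure under products is read off from the grading: the factors of each convolution
  term at l have degrees g and g^{-1} l, so the term has degree l.\<close>

lemma assoc_algebra_inv_alg: "assoc_algebra K inv_alg"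
proof -
  interpret B: assoc_algebra K B by (rule assoc_algebra_tga)
  let ?S = "\<Pi>\<^sub>E g \<in> carrier G. hp g"
  have sub: "?S \<subseteq> carrier B"
    using carrier_inv_alg by (auto simp: invariant_subring_def)
  have SI: "x \<in> ?S" if "x \<in> carrier B" "\<And>g. g \<in> carrier G \<Longrightarrow> x g \<in> hp g" for x
    using that by (auto simp: twisted_group_algebra_def)
  have "x \<otimes>\<^bsub>B\<^esub> y \<in> ?S" if xy: "x \<in> ?S" "y \<in> ?S" for x y
  proof (rule SI)
    fix l assume l: "l \<in> carrier G"
    have xyB: "x \<in> carrier B" "y \<in> carrier B" using xy sub by auto
    show "(x \<otimes>\<^bsub>B\<^esub> y) l \<in> hp l"
      unfolding tga_mult_app[OF xyB l]
    proof (intro hp_finsum fin_G l hp_smult)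
      fix g assume g: "g \<in> carrier G"
      have "x g \<otimes>\<^bsub>A\<^esub> y (inv\<^bsub>G\<^esub> g \<otimes>\<^bsub>G\<^esub> l) \<in> hp (g \<otimes>\<^bsub>G\<^esub> (inv\<^bsub>G\<^esub> g \<otimes>\<^bsub>G\<^esub> l))"
        using xy g l by (intro hp_mult) (auto simp: PiE_iff)
      then show "x g \<otimes>\<^bsub>A\<^esub> y (inv\<^bsub>G\<^esub> g \<otimes>\<^bsub>G\<^esub> l) \<in> hp l"
        using g l by (simp add: G.m_assoc[symmetric])
    qed (use l in auto)
  qed (use xy sub in auto)
  moreover have "x \<oplus>\<^bsub>B\<^esub> y \<in> ?S" if xy: "x \<in> ?S" "y \<in> ?S" for x y
    using xy subsetD[OF sub] by (intro SI) (auto simp: tga_app intro!: hp_add)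
  moreover have "c \<odot>\<^bsub>B\<^esub> x \<in> ?S" if "c \<in> carrier K" "x \<in> ?S" for c x
    using that subsetD[OF sub] by (intro SI) (auto simp: tga_app intro!: hp_smult)
  moreover have "\<one>\<^bsub>B\<^esub> \<in> ?S"
    by (intro SI) (auto simp: tga_app hp_one hp_zero)
  ultimately have "assoc_algebra K (B\<lparr>carrier := ?S\<rparr>)"
    using sub by (intro B.subalgebra) auto
  then show ?thesis
    using carrier_inv_alg by (simp add: invariant_subring_def)
qed

section \<open>The summation map from the invariants to the twist\<close>

definition sigma :: "('g \<Rightarrow> 'a) \<Rightarrow> 'a" where
  "sigma x = (\<Oplus>\<^bsub>A\<^esub> g \<in> carrier G. x g)"

abbreviation twist where "twist \<equiv> cocycle_twist A G \<phi> \<chi> \<mu>"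

text \<open>\<open>homogeneous_components\<close> undoes \<open>sigma\<close> on the invariants, and
  the family of projections of a is a preimage of a.\<close>

lemma bij_sigma: "bij_betw sigma (carrier inv_alg) (carrier twist)"
proof (rule bij_betw_imageI)
  show "inj_on sigma (carrier inv_alg)"
    unfolding carrier_inv_alg sigma_def by (metis (no_types, lifting) homogeneous_components_finsum inj_onI)
  have "a \<in> sigma ` carrier inv_alg" if a: "a \<in> carrier A" for a
  proof
    show "a = sigma (\<lambda>g \<in> carrier G. proj g a)"
    proof -
      have "sigma (\<lambda>g \<in> carrier G. proj g a) = (\<Oplus>\<^bsub>A\<^esub> g \<in> carrier G. proj g a)"
        unfolding sigma_def using a proj_in_hp[THEN hp_closed] by (intro A.M.finsum_cong') auto
      then show ?thesis by (simp add: sum_proj[OF a])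
    qed
    show "(\<lambda>g \<in> carrier G. proj g a) \<in> carrier inv_alg"
      unfolding carrier_inv_alg using a proj_in_hp by auto
  qed
  moreover have "sigma x \<in> carrier A" if "x \<in> carrier inv_alg" for x
    using that hp_closed by (auto simp: sigma_def carrier_inv_alg intro!: A.M.finsum_closed)
  ultimately show "sigma ` carrier inv_alg = carrier twist"
    by (auto simp: cocycle_twist_def)
qed

text \<open>For products, summing the convolution over all l and substituting h for g^{-1} l leaves
  a free double sum over g and h. This is the twisted product because the components of
  \<open>sigma x\<close> are the values of x.\<close>

lemma sigma_hom:
  assumes x: "x \<in> carrier inv_alg" and y: "y \<in> carrier inv_alg" and c: "c \<in> carrier K"
  shows "sigma (x \<oplus>\<^bsub>inv_alg\<^esub> y) = sigma x \<oplus>\<^bsub>twist\<^esub> sigma y"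
    and "sigma (x \<otimes>\<^bsub>inv_alg\<^esub> y) = sigma x \<otimes>\<^bsub>twist\<^esub> sigma y"
    and "sigma (c \<odot>\<^bsub>inv_alg\<^esub> x) = c \<odot>\<^bsub>twist\<^esub> sigma x"
proof -
  have xyB: "x \<in> carrier B" "y \<in> carrier B" using x y by (auto simp: invariant_subring_def)
  then have xg: "x g \<in> carrier A" "y g \<in> carrier A" if "g \<in> carrier G" for g
    using that by auto
  have "sigma (x \<oplus>\<^bsub>B\<^esub> y) = (\<Oplus>\<^bsub>A\<^esub> g \<in> carrier G. x g \<oplus>\<^bsub>A\<^esub> y g)"
    unfolding sigma_def using xg by (intro A.M.finsum_cong') (auto simp: tga_app)
  also have "\<dots> = sigma x \<oplus>\<^bsub>A\<^esub> sigma y"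
    unfolding sigma_def using xg by (intro A.M.finsum_addf) auto
  finally show "sigma (x \<oplus>\<^bsub>inv_alg\<^esub> y) = sigma x \<oplus>\<^bsub>twist\<^esub> sigma y"
    by (simp add: cocycle_twist_def invariant_subring_def)
  have "sigma (c \<odot>\<^bsub>B\<^esub> x) = (\<Oplus>\<^bsub>A\<^esub> g \<in> carrier G. c \<odot>\<^bsub>A\<^esub> x g)"
    unfolding sigma_def using xg c by (intro A.M.finsum_cong') (auto simp: tga_app)
  also have "\<dots> = c \<odot>\<^bsub>A\<^esub> sigma x"
    unfolding sigma_def using xg c fin_G by (intro A.finsum_smult_ldistr[symmetric]) auto
  finally show "sigma (c \<odot>\<^bsub>inv_alg\<^esub> x) = c \<odot>\<^bsub>twist\<^esub> sigma x"
    by (simp add: cocycle_twist_def invariant_subring_def)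
  have comp: "homogeneous_components A G \<phi> \<chi> (sigma z) = z" if "z \<in> carrier inv_alg" for z
    using that unfolding sigma_def carrier_inv_alg by (rule homogeneous_components_finsum)
  let ?F = "\<lambda>g h. \<mu> g h \<odot>\<^bsub>A\<^esub> (x g \<otimes>\<^bsub>A\<^esub> y h)"
  have F: "?F g h \<in> carrier A" if "g \<in> carrier G" "h \<in> carrier G" for g h
    using that xg by simp
  have "sigma (x \<otimes>\<^bsub>inv_alg\<^esub> y) =
    (\<Oplus>\<^bsub>A\<^esub> l \<in> carrier G. \<Oplus>\<^bsub>A\<^esub> g \<in> carrier G. ?F g (inv\<^bsub>G\<^esub> g \<otimes>\<^bsub>G\<^esub> l))"
    using xyB F by (auto simp: sigma_def invariant_subring_def tga_mult_app
        intro!: A.M.finsum_cong' A.M.finsum_closed)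
  also have "\<dots> = (\<Oplus>\<^bsub>A\<^esub> g \<in> carrier G. \<Oplus>\<^bsub>A\<^esub> l \<in> carrier G. ?F g (inv\<^bsub>G\<^esub> g \<otimes>\<^bsub>G\<^esub> l))"
    using F fin_G by (intro A.M.finsum_swap) auto
  also have "\<dots> = (\<Oplus>\<^bsub>A\<^esub> g \<in> carrier G. \<Oplus>\<^bsub>A\<^esub> h \<in> carrier G. ?F g h)"
  proof (rule A.M.finsum_cong'[OF refl])
    fix g assume g: "g \<in> carrier G"
    show "(\<Oplus>\<^bsub>A\<^esub> l \<in> carrier G. ?F g (inv\<^bsub>G\<^esub> g \<otimes>\<^bsub>G\<^esub> l)) = (\<Oplus>\<^bsub>A\<^esub> h \<in> carrier G. ?F g h)"
      using g F by (intro A.M.finsum_translate[OF G.is_group, of _ "?F g"]) auto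
  qed (use F in \<open>auto intro!: A.M.finsum_closed\<close>)
  also have "\<dots> = sigma x \<otimes>\<^bsub>twist\<^esub> sigma y"
    by (simp add: cocycle_twist_def comp x y)
  finally show "sigma (x \<otimes>\<^bsub>inv_alg\<^esub> y) = sigma x \<otimes>\<^bsub>twist\<^esub> sigma y" .
qed

lemma sigma_one: "sigma \<one>\<^bsub>inv_alg\<^esub> = \<one>\<^bsub>twist\<^esub>"
proof -
  have "sigma \<one>\<^bsub>inv_alg\<^esub> = (\<Oplus>\<^bsub>A\<^esub> g \<in> carrier G. if \<one>\<^bsub>G\<^esub> = g then \<one>\<^bsub>A\<^esub> else \<zero>\<^bsub>A\<^esub>)"
    unfolding sigma_def by (intro A.M.finsum_cong') (auto simp: invariant_subring_def tga_app)
  also have "\<dots> = \<one>\<^bsub>A\<^esub>"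
    using fin_G A.M.finsum_singleton[of "\<one>\<^bsub>G\<^esub>" "carrier G" "\<lambda>_. \<one>\<^bsub>A\<^esub>"] by simp
  finally show ?thesis by (simp add: cocycle_twist_def)
qed

lemma sigma_zero: "sigma \<zero>\<^bsub>inv_alg\<^esub> = \<zero>\<^bsub>twist\<^esub>"
  by (auto simp: sigma_def invariant_subring_def cocycle_twist_def tga_app intro!: A.M.add.finprod_one_eqI)

lemma twist_isomorphic_inv_alg: "alg_isomorphic K twist inv_alg"
proof -
  interpret I: assoc_algebra K inv_alg by (rule assoc_algebra_inv_alg)
  have cl: "sigma x \<in> carrier twist" if "x \<in> carrier inv_alg" for x
    using bij_sigma that by (rule bij_betwE[rule_format])
  have twist: "assoc_algebra K twist"
    using assoc_algebra_inv_alg bij_betw_imp_surj_on[OF bij_sigma]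
    by (rule assoc_algebra_hom_image)
      (use sigma_hom(1,2)[OF _ _ K.zero_closed] sigma_hom(3) sigma_one sigma_zero in auto)
  have iso: "sigma \<in> ring_iso inv_alg twist"
    by (rule ring_iso_memI) (use sigma_hom(1,2)[OF _ _ K.zero_closed] sigma_one cl bij_sigma in auto)
  \<comment> \<open>The isomorphism is wanted from the twist to the invariants, against the
    direction of \<open>sigma\<close>. Its inverse inherits linearity by writing each element of the
    twist as \<open>sigma x\<close>.\<close>
  let ?f = "inv_into (carrier inv_alg) sigma"
  have "?f (c \<odot>\<^bsub>twist\<^esub> a) = c \<odot>\<^bsub>inv_alg\<^esub> ?f a"
    if c: "c \<in> carrier K" and a: "a \<in> carrier twist" for c a
  proof -
    obtain x where x: "x \<in> carrier inv_alg" "a = sigma x"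
      using a bij_sigma by (auto simp: bij_betw_def)
    show ?thesis
      unfolding x(2) sigma_hom(3)[OF x(1) x(1) c, symmetric]
      using x(1) c bij_betw_inv_into_left[OF bij_sigma] by simp
  qed
  then have "?f \<in> alg_iso K twist inv_alg"
    using ring_iso_set_sym[OF I.ring_axioms iso] by (simp add: alg_iso_def)
  then show ?thesis
    using twist assoc_algebra_inv_alg by (auto simp: alg_isomorphic_def)
qed

end

theorem proposition1p1p11:
  fixes K :: "('k, 'l) ring_scheme"
    and A :: "('k, 'a, 'm) module_scheme"
    and G :: "('g, 'n) monoid_scheme"
    and \<phi> :: "'g \<Rightarrow> 'a \<Rightarrow> 'a"
    and \<chi> \<mu> :: "'g \<Rightarrow> 'g \<Rightarrow> 'k"
  assumes "algebraically_closed K"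
    and "assoc_algebra K A"
    and "comm_group G" and "finite (carrier G)"
    and "\<not> ring_char K dvd order G"
    and "acts_by_alg_auts K A G \<phi>"
    and "\<chi> \<in> iso G (character_group G K)"
    and "normalised_2_cocycle G K \<mu>"
  shows "alg_isomorphic K (cocycle_twist A G \<phi> \<chi> \<mu>)
    (invariant_subring G (twisted_action A G \<phi> \<chi>) (twisted_group_algebra A G \<mu>))"
proof -
  interpret twist_data K A G \<chi> \<mu> \<phi>
    using assms
    by (intro twist_data.intro self_dual_group.intro twisted_setting.intro
        self_dual_group_axioms.intro twisted_setting_axioms.intro twist_data_axioms.intro)
      (auto simp: algebraically_closed_def)
  show ?thesis by (rule twist_isomorphic_inv_alg)
qed

end
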